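(* Let $D^-$ be the additive code defined in the context and $\Gamma_{D^-}$ its coset graph. Then $\Gamma_{D^-}$ (which has $2^{10}$ vertices) is distance-regular of diameter $3$, with spectrum $\{27^1,9^{198},1^{495},(-7)^{330}\}$ (exponents are multiplicities), and its successive degrees (the numbers of vertices at distance $0,1,2,3$ from any given vertex) are $(1,33,495,495)$.
   Context: $\mathbb{F}_4=\{0,1,\omega,\omega^2\}$ with $\omega^2=\omega+1$; $\mathrm{Tr}(z)=z+z^2$. An additive code of length $n$ over $\mathbb{F}_4$ is an additive subgroup of $\mathbb{F}_4^n$. The trace inner product on $\mathbb{F}_4^n$ is $x*y=\sum_i \mathrm{Tr}(x_iy_i^2)\in\mathbb{F}_2$. The coset graph $\Gamma_C$ of an additive code $C\subseteq\mathbb{F}_4^n$ has as vertices the cosets $x+C$, $x\in\mathbb{F}_4^n$, two cosets being adjacent if they differ by (i.e. their difference contains) a vector of Hamming weight $1$; equivalently it is the graph on syndromes $H\star x=(H_1*x,\dots,H_m*x)^T$ where $H$ is a parity check matrix (a matrix whose rows $\mathbb{F}_2$-span the trace dual of $C$), two syndromes adjacent iff they differ by the syndrome of a weight-$1$ vector. $D^-$ is the $\mathbb{F}_2$-span of the following $12$ vectors of $\mathbb{F}_4^{11}$: $(0,0,0,0,0,\omega^2,\omega^2,0,\omega,1,\omega)$, $(0,0,0,0,0,\omega,0,\omega,\omega,\omega,1)$, $(1,0,0,0,0,1,0,1,\omega^2,\omega^2,1)$, $(\omega,0,0,0,0,0,\omega,1,\omega,\omega,\omega)$, $(0,1,0,0,0,0,1,1,1,\omega^2,\omega^2)$,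 $(0,\omega,0,0,0,\omega^2,1,\omega^2,\omega,\omega,0)$, $(0,0,1,0,0,\omega,\omega,1,1,0,1)$, $(0,0,\omega,0,0,\omega,1,\omega,\omega^2,\omega^2,0)$, $(0,0,0,1,0,\omega,\omega,\omega,0,1,\omega)$, $(0,0,0,\omega,0,\omega^2,1,1,\omega^2,0,\omega)$, $(0,0,0,0,1,\omega^2,\omega^2,\omega^2,1,0,\omega^2)$, $(0,0,0,0,\omega,\omega,1,0,1,\omega,\omega)$. (It is equivalent to the dodecacode punctured in one coordinate; it has $4^6$ codewords.)
   Formalization: The printed eigenvalue 27 is corrected to 33: the graph is 33-regular, so 33 is an eigenvalue, and the printed spectrum would have trace -6 instead of 0; the spectrum proved is {33^1, 9^198, 1^495, (-7)^330}. *)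

theory Defs
  imports
    "Graph_Theory.Graph_Theory"
    "Jordan_Normal_Form.Char_Poly"
    "HOL-Analysis.Cartesian_Space"
    "HOL-Library.Z2"
begin

subsection \<open>The field with four elements\<close>

datatype gf4 = GF4_0 | GF4_1 | Omega (\<open>\<omega>\<close>) | Omega2

instantiation gf4 :: field
begin

definition zero_gf4 :: gf4 where "0 = GF4_0"
definition one_gf4 :: gf4 where "1 = GF4_1"

fun plus_gf4 :: "gf4 \<Rightarrow> gf4 \<Rightarrow> gf4" where
  "GF4_0 + y = y"
| "x + GF4_0 = x"
| "GF4_1 + GF4_1 = GF4_0"
| "GF4_1 + \<omega> = Omega2"
| "GF4_1 + Omega2 = \<omega>"
| "\<omega> + GF4_1 = Omega2"
| "\<omega> + \<omega> = GF4_0"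
| "\<omega> + Omega2 = GF4_1"
| "Omega2 + GF4_1 = \<omega>"
| "Omega2 + \<omega> = GF4_1"
| "Omega2 + Omega2 = GF4_0"

fun times_gf4 :: "gf4 \<Rightarrow> gf4 \<Rightarrow> gf4" where
  "GF4_0 * y = GF4_0"
| "x * GF4_0 = GF4_0"
| "GF4_1 * y = y"
| "x * GF4_1 = x"
| "\<omega> * \<omega> = Omega2"
| "\<omega> * Omega2 = GF4_1"
| "Omega2 * \<omega> = GF4_1"
| "Omega2 * Omega2 = \<omega>"

fun inverse_gf4 :: "gf4 \<Rightarrow> gf4" where
  "inverse GF4_0 = GF4_0"
| "inverse GF4_1 = GF4_1"
| "inverse \<omega> = Omega2"
| "inverse Omega2 = \<omega>"

definition uminus_gf4 :: "gf4 \<Rightarrow> gf4" where "- x = (x :: gf4)"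
definition minus_gf4 :: "gf4 \<Rightarrow> gf4 \<Rightarrow> gf4" where "x - y = x + (y :: gf4)"
definition divide_gf4 :: "gf4 \<Rightarrow> gf4 \<Rightarrow> gf4" where "x div y = x * inverse (y :: gf4)"

instance
proof
  fix x y z :: gf4
  show "x + y + z = x + (y + z)" by (cases x; cases y; cases z) simp_all
  show "x + y = y + x" by (cases x; cases y) simp_all
  show "0 + x = x" by (simp add: zero_gf4_def)
  show "- x + x = 0" by (cases x) (simp_all add: zero_gf4_def uminus_gf4_def)
  show "x - y = x + - y" by (simp add: minus_gf4_def uminus_gf4_def)
  show "x * y * z = x * (y * z)" by (cases x; cases y; cases z) simp_all
  show "x * y = y * x" by (cases x; cases y) simp_all
  show "1 * x = x" by (cases x) (simp_all add: one_gf4_def)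
  show "(x + y) * z = x * z + y * z" by (cases x; cases y; cases z) simp_all
  show "(0::gf4) \<noteq> 1" by (simp add: zero_gf4_def one_gf4_def)
  show "x \<noteq> 0 \<Longrightarrow> inverse x * x = 1" by (cases x) (simp_all add: zero_gf4_def one_gf4_def)
  show "x div y = x * inverse y" by (simp add: divide_gf4_def)
  show "inverse (0::gf4) = 0" by (simp add: zero_gf4_def)
qed

end

lemma UNIV_gf4: "UNIV = {0, 1, \<omega>, \<omega>\<^sup>2}"
proof -
  have "x \<in> {0, 1, \<omega>, \<omega>\<^sup>2}" for x
    by (cases x) (simp_all add: zero_gf4_def one_gf4_def power2_eq_square)
  then show ?thesis by blast
qed

instance gf4 :: finite
  by standard (simp add: UNIV_gf4)

lemma omega_square: "\<omega>\<^sup>2 = \<omega> + 1"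
  by (simp add: one_gf4_def power2_eq_square)


subsection \<open>Additive codes and their coset graphs\<close>

definition hamming_weight :: "gf4 ^ 'n \<Rightarrow> nat" where
  "hamming_weight x = card {i. vec_nth x i \<noteq> 0}"

definition f2_scale :: "bit \<Rightarrow> gf4 ^ 'n \<Rightarrow> gf4 ^ 'n" where
  "f2_scale c x = (if c = 0 then 0 else x)"

lemma gf4_add_self: "x + x = (0 :: gf4)"
  by (cases x) (simp_all add: zero_gf4_def)

interpretation f2: vector_space "f2_scale :: bit \<Rightarrow> gf4 ^ 'n \<Rightarrow> gf4 ^ 'n"
proof
  fix a b :: bit and x y :: "gf4 ^ 'n"
  show "f2_scale a (x + y) = f2_scale a x + f2_scale a y"
    by (simp add: f2_scale_def)
  have "x + x = 0"
    unfolding vec_eq_iff vector_add_component gf4_add_self by simp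
  then show "f2_scale (a + b) x = f2_scale a x + f2_scale b x"
    by (cases a; cases b) (simp_all add: f2_scale_def)
  show "f2_scale a (f2_scale b x) = f2_scale (a * b) x"
    by (simp add: f2_scale_def)
  show "f2_scale 1 x = x"
    by (simp add: f2_scale_def)
qed

definition coset :: "gf4 ^ 'n \<Rightarrow> (gf4 ^ 'n) set \<Rightarrow> (gf4 ^ 'n) set" where
  "coset x C = {x + c |c. c \<in> C}"

(* An undirected graph is represented by its symmetric set of ordered pairs of adjacent vertices. *)
definition coset_graph :: "(gf4 ^ 'n) set \<Rightarrow> (gf4 ^ 'n) set pair_pre_digraph" where
  "coset_graph C =
    \<lparr> pverts = {coset x C |x. True},
      parcs = {(X, Y). X \<in> {coset x C |x. True} \<and> Y \<in> {coset x C |x. True} \<and>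
                       (\<exists>x\<in>X. \<exists>y\<in>Y. hamming_weight (x - y) = 1)} \<rparr>"


subsection \<open>Distance-regular graphs and spectra\<close>

definition graph_dist :: "'v pair_pre_digraph \<Rightarrow> 'v \<Rightarrow> 'v \<Rightarrow> ereal" where
  "graph_dist G u v = wf_digraph.\<mu> (with_proj G) (\<lambda>_. 1) u v"

definition diameter :: "'v pair_pre_digraph \<Rightarrow> ereal" where
  "diameter G = (SUP u\<in>pverts G. SUP v\<in>pverts G. graph_dist G u v)"

definition sphere_at :: "'v pair_pre_digraph \<Rightarrow> 'v \<Rightarrow> nat \<Rightarrow> 'v set" where
  "sphere_at G u i = {v \<in> pverts G. graph_dist G u v = ereal (real i)}"

definition neighbours :: "'v pair_pre_digraph \<Rightarrow> 'v \<Rightarrow> 'v set" where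
  "neighbours G v = {w. (v, w) \<in> parcs G}"

(* b i and c i are the entries of the intersection array; the case split only concerns c 0,
   for which there is no sphere of radius -1. *)
definition distance_regular :: "'v pair_pre_digraph \<Rightarrow> bool" where
  "distance_regular G \<longleftrightarrow>
     pair_graph G \<and> Digraph_Component.connected (with_proj G) \<and>
     (\<exists>b c :: nat \<Rightarrow> nat. \<forall>u\<in>pverts G. \<forall>i. \<forall>v\<in>sphere_at G u i.
        card (neighbours G v \<inter> sphere_at G u (i + 1)) = b i \<and>
        (i \<ge> 1 \<longrightarrow> card (neighbours G v \<inter> sphere_at G u (i - 1)) = c i))"

definition adjacency_mat :: "'v pair_pre_digraph \<Rightarrow> 'v list \<Rightarrow> real Matrix.mat" where
  "adjacency_mat G vs =
     Matrix.mat (length vs) (length vs) (\<lambda>(i, j). if (vs ! i, vs ! j) \<in> parcs G then 1 else 0)"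

(* S is the multiset of eigenvalues, repeated according to multiplicity, of the adjacency matrix
   with respect to every ordering vs of the vertices. *)
definition has_spectrum :: "'v pair_pre_digraph \<Rightarrow> real multiset \<Rightarrow> bool" where
  "has_spectrum G S \<longleftrightarrow>
     finite (pverts G) \<and>
     (\<forall>vs. distinct vs \<and> set vs = pverts G \<longrightarrow> proots (char_poly (adjacency_mat G vs)) = S)"


subsection \<open>The punctured dodecacode\<close>

definition D_minus :: "(gf4 ^ 11) set" where
  "D_minus = f2.span
    {vector [0, 0, 0, 0, 0, \<omega>\<^sup>2, \<omega>\<^sup>2, 0, \<omega>, 1, \<omega>],
     vector [0, 0, 0, 0, 0, \<omega>, 0, \<omega>, \<omega>, \<omega>, 1],
     vector [1, 0, 0, 0, 0, 1, 0, 1, \<omega>\<^sup>2, \<omega>\<^sup>2, 1],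
     vector [\<omega>, 0, 0, 0, 0, 0, \<omega>, 1, \<omega>, \<omega>, \<omega>],
     vector [0, 1, 0, 0, 0, 0, 1, 1, 1, \<omega>\<^sup>2, \<omega>\<^sup>2],
     vector [0, \<omega>, 0, 0, 0, \<omega>\<^sup>2, 1, \<omega>\<^sup>2, \<omega>, \<omega>, 0],
     vector [0, 0, 1, 0, 0, \<omega>, \<omega>, 1, 1, 0, 1],
     vector [0, 0, \<omega>, 0, 0, \<omega>, 1, \<omega>, \<omega>\<^sup>2, \<omega>\<^sup>2, 0],
     vector [0, 0, 0, 1, 0, \<omega>, \<omega>, \<omega>, 0, 1, \<omega>],
     vector [0, 0, 0, \<omega>, 0, \<omega>\<^sup>2, 1, 1, \<omega>\<^sup>2, 0, \<omega>],
     vector [0, 0, 0, 0, 1, \<omega>\<^sup>2, \<omega>\<^sup>2, \<omega>\<^sup>2, 1, 0, \<omega>\<^sup>2],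
     vector [0, 0, 0, 0, \<omega>, \<omega>, 1, 0, 1, \<omega>, \<omega>]}"

end

theory Submission
  imports Defs
begin

text \<open>
  Write \<open>C\<close> for the code and \<open>Y\<close> for its trace dual, which is spanned by the last ten generators.
  The characters \<open>x \<mapsto> (-1)^(x*y)\<close> with \<open>y \<in> Y\<close> are constant on the cosets of \<open>C\<close> and
  diagonalise the coset graph, with eigenvalue \<open>33 - 4 wt(y)\<close>. As \<open>Y\<close> has the weights 0, 6, 8, 10
  with multiplicities 1, 198, 495, 330, this is the spectrum, and the adjacency matrix satisfies
  \<open>(A - 9)(A - 1)(A + 7) = 30 J\<close>. The distance between two cosets is the minimum weight of their
  difference. Since \<open>C\<close> has minimum distance 5, the balls of radius 2 in \<open>gf4 ^ 11\<close> embed in the quotient, so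
  that \<open>A\<^sup>2 = 33 + 2A + 2A\<^sub>2\<close>. Substituting this into the cubic relation yields
  \<open>A A\<^sub>2 = 30 A + 16 A\<^sub>2 + 15 A\<^sub>3\<close>, where \<open>A\<^sub>3 = J - 1 - A - A\<^sub>2\<close>. Hence there is no vertex at distance 4,
  and the intersection array is \<open>{33, 30, 15; 1, 2, 15}\<close>.
\<close>

subsection \<open>Enumeration of spans\<close>

lemma gf4_vec_add_self: "x + x = (0 :: gf4 ^ 'n)"
  unfolding vec_eq_iff vector_add_component gf4_add_self by simp

lemma gf4_vec_diff_eq_add: "x - y = x + (y :: gf4 ^ 'n)"
  by (simp add: vec_eq_iff minus_gf4_def)

lemma gf4_vec_add_left_self: "x + (x + y) = (y :: gf4 ^ 'n)"
  by (simp add: add.assoc[symmetric] gf4_vec_add_self)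

text \<open>In characteristic 2 these rules cancel equal summands wherever they stand in a
  sum.\<close>

lemmas gf4_vec_ac = ac_simps gf4_vec_add_self gf4_vec_add_left_self

text \<open>A list rather than a set, so that repetitions stay visible: it is distinct exactly when
  the generators are independent over the prime field.\<close>

fun combos :: "(gf4 ^ 'n) list \<Rightarrow> (gf4 ^ 'n) list" where
  "combos [] = [0]"
| "combos (h # hs) = combos hs @ map ((+) h) (combos hs)"

lemma length_combos: "length (combos hs) = 2 ^ length hs"
  by (induction hs) auto

text \<open>The only scalars are 0 and 1, so a further generator \<open>h\<close> adds just the
  translate of the old span by \<open>h\<close>.\<close>

lemma set_combos: "set (combos hs) = f2.span (set hs)"
proof (induction hs)
  case Nil
  show ?case by simp
next
  case (Cons h hs)
  have "x \<in> set (combos (h # hs)) \<longleftrightarrow> (\<exists>k. x - f2_scale k h \<in> f2.span (set hs))" for x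
  proof -
    have "x \<in> (+) h ` f2.span (set hs) \<longleftrightarrow> x - h \<in> f2.span (set hs)"
      by (force simp: image_iff algebra_simps)
    moreover have "(\<exists>k. x - f2_scale k h \<in> f2.span (set hs)) \<longleftrightarrow>
        x \<in> f2.span (set hs) \<or> x - h \<in> f2.span (set hs)"
      by (auto simp: f2_scale_def split: if_splits intro: exI[of _ 0] exI[of _ 1])
    ultimately show ?thesis using Cons by auto
  qed
  then show ?case by (auto simp: f2.span_insert)
qed

text \<open>Reduces independence to counting zeros. If \<open>h\<close> lay in the span of the rest,
  \<open>h + h\<close> would be a second zero; otherwise the two halves of the list are
  disjoint.\<close>

lemma distinct_combos:
  assumes "length (filter (\<lambda>x. x = 0) (combos hs)) = 1"
  shows "distinct (combos hs)"
  using assms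
proof (induction hs)
  case (Cons h hs)
  have "0 \<in> set (combos hs)" by (simp add: set_combos f2.span_zero)
  then have "length (filter (\<lambda>x. x = 0) (combos hs)) \<noteq> 0" by (simp add: filter_empty_conv)
  with Cons.prems have one: "length (filter (\<lambda>x. x = 0) (combos hs)) = 1"
    and none: "length (filter (\<lambda>x. x = 0) (map ((+) h) (combos hs))) = 0"
    unfolding combos.simps filter_append length_append by linarith+
  have h: "h \<notin> f2.span (set hs)"
  proof
    assume "h \<in> f2.span (set hs)"
    then have "h + h \<in> set (map ((+) h) (combos hs))" by (auto simp: set_combos)
    with none show False unfolding gf4_vec_add_self by (auto simp: filter_empty_conv)
  qed
  have "set (combos hs) \<inter> set (map ((+) h) (combos hs)) = {}"
  proof -
    have "h + y \<notin> f2.span (set hs)" if "y \<in> f2.span (set hs)" for y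
      using f2.span_diff[of "h + y" "set hs" y] that h by auto
    then show ?thesis by (auto simp: set_combos)
  qed
  with Cons.IH[OF one] show ?case by (simp add: distinct_map)
qed simp

section \<open>Coordinates indexed by the type \<open>11\<close>, and weights by evaluation\<close>

lemma of_nat_11_neq_0: "0 < j \<Longrightarrow> j < 11 \<Longrightarrow> (of_nat j :: 11) \<noteq> 0"
proof -
  assume "0 < j" "j < 11"
  then have "j = 1 \<or> j = 2 \<or> j = 3 \<or> j = 4 \<or> j = 5 \<or> j = 6 \<or> j = 7 \<or> j = 8 \<or> j = 9 \<or> j = 10"
    by presburger
  then show ?thesis by (elim disjE) simp_all
qed

text \<open>The shift by \<open>Suc\<close> is there because \<open>vector\<close> puts the head of
  its list at index 1; the last entry then sits at index 11, which is 0 in this cyclic type.\<close>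

lemma bij_betw_of_nat_Suc_11: "bij_betw (\<lambda>k. of_nat (Suc k) :: 11) {..<11} UNIV"
proof -
  have neq: "(of_nat (Suc a) :: 11) \<noteq> of_nat (Suc b)" if "a < b" "b < 11" for a b
  proof
    assume "(of_nat (Suc a) :: 11) = of_nat (Suc b)"
    also have "Suc b = Suc a + (b - a)" using that by simp
    finally have "(of_nat (b - a) :: 11) = 0" by (simp only: of_nat_add) simp
    with of_nat_11_neq_0[of "b - a"] that show False by linarith
  qed
  have inj: "inj_on (\<lambda>k. of_nat (Suc k) :: 11) {..<11}"
    by (rule inj_onI) (metis neq lessThan_iff linorder_neqE_nat)
  then have "card ((\<lambda>k. of_nat (Suc k) :: 11) ` {..<11}) = CARD(11)"
    by (simp add: card_image)
  then have "(\<lambda>k. of_nat (Suc k) :: 11) ` {..<11} = UNIV"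
    by (intro card_subset_eq) simp_all
  with inj show ?thesis by (simp add: bij_betw_def)
qed

text \<open>The length bound excludes wrap-around: a later entry lies 1 to 10 places after the head
  and is not overwritten by it.\<close>

lemma vector_nth_11:
  assumes "length l \<le> 11" "k < length l"
  shows "vec_nth (vector l :: 'a::zero ^ 11) (of_nat (Suc k)) = l ! k"
proof -
  \<comment> \<open>The start index is generalised from 1 to \<open>m\<close>, since it advances
    with each entry.\<close>
  have "foldr (\<lambda>x f n. (f (n + 1))(n := x)) l (\<lambda>n x. 0) m (m + of_nat k) = l ! k" for m :: 11
    using assms
  proof (induction l arbitrary: m k)
    case (Cons x l)
    show ?case
    proof (cases k)
      case (Suc k')
      have "foldr (\<lambda>x f n. (f (n + 1))(n := x)) l (\<lambda>n x. 0) (m + 1) (m + 1 + of_nat k') = l ! k'"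
        using Cons.prems Suc by (intro Cons.IH) auto
      moreover have "(of_nat (Suc k') :: 11) \<noteq> 0"
        using Cons.prems Suc by (intro of_nat_11_neq_0) auto
      ultimately show ?thesis using Suc by (simp add: add.assoc fun_upd_def)
    qed simp
  qed simp
  from this[of 1] show ?thesis by (simp add: vector_def)
qed

lemma of_nat_Suc_11_cases:
  obtains k where "k < 11" "(i :: 11) = of_nat (Suc k)"
  using bij_betw_imp_surj_on[OF bij_betw_of_nat_Suc_11] by blast

lemma vec_eq_iff_11:
  "(x :: 'a ^ 11) = y \<longleftrightarrow> (\<forall>k<11. vec_nth x (of_nat (Suc k)) = vec_nth y (of_nat (Suc k)))"
  unfolding vec_eq_iff by (metis of_nat_Suc_11_cases)

text \<open>Defined by constructor patterns so that it evaluates cheaply.\<close>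

fun list_weight :: "gf4 list \<Rightarrow> nat" where
  "list_weight [] = 0"
| "list_weight (GF4_0 # xs) = list_weight xs"
| "list_weight (GF4_1 # xs) = Suc (list_weight xs)"
| "list_weight (\<omega> # xs) = Suc (list_weight xs)"
| "list_weight (Omega2 # xs) = Suc (list_weight xs)"

lemma list_weight_eq: "list_weight xs = length (filter (\<lambda>x. x \<noteq> 0) xs)"
  by (induction xs rule: list_weight.induct) (simp_all add: zero_gf4_def)

lemma hamming_weight_vector:
  assumes "length l = 11"
  shows "hamming_weight (vector l :: gf4 ^ 11) = list_weight l"
proof -
  have "bij_betw (\<lambda>k. of_nat (Suc k) :: 11) {k. k < 11 \<and> l ! k \<noteq> 0} {i. vec_nth (vector l) i \<noteq> 0}"
  proof (rule bij_betw_subset[OF bij_betw_of_nat_Suc_11 _ equalityI])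
    show "{i. vec_nth (vector l) i \<noteq> 0} \<subseteq> (\<lambda>k. of_nat (Suc k) :: 11) ` {k. k < 11 \<and> l ! k \<noteq> 0}"
    proof
      fix i :: 11
      assume "i \<in> {i. vec_nth (vector l) i \<noteq> 0}"
      moreover obtain k where "k < 11" "i = of_nat (Suc k)" by (rule of_nat_Suc_11_cases)
      ultimately show "i \<in> (\<lambda>k. of_nat (Suc k) :: 11) ` {k. k < 11 \<and> l ! k \<noteq> 0}"
        using vector_nth_11[of l k] assms by auto
    qed
  qed (use vector_nth_11[of l] assms in \<open>auto simp del: of_nat_Suc\<close>)
  from bij_betw_same_card[OF this] show ?thesis
    by (simp add: hamming_weight_def list_weight_eq length_filter_conv_card assms)
qed

lemma vector_add_11:
  assumes "length l = 11" "length l' = 11"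
  shows "(vector l + vector l' :: gf4 ^ 11) = vector (map2 (+) l l')"
  using assms by (simp add: vec_eq_iff_11 vector_nth_11 del: of_nat_Suc)

text \<open>A depth-first count, so that evaluation never builds the list of all combinations.\<close>

fun count_combos :: "(nat \<Rightarrow> bool) \<Rightarrow> gf4 list list \<Rightarrow> gf4 list \<Rightarrow> nat" where
  "count_combos P [] a = (if P (list_weight a) then 1 else 0)"
| "count_combos P (h # hs) a = count_combos P hs a + count_combos P hs (map2 (+) h a)"

text \<open>The accumulator \<open>a\<close> is the sum of the generators chosen so far, hence the
  translate by \<open>vector a\<close>.\<close>

lemma count_combos_correct:
  assumes "\<forall>h\<in>set hs. length h = 11" "length a = 11"
  shows "count_combos P hs a =
    length (filter (\<lambda>x. P (hamming_weight (vector a + x))) (combos (map (\<lambda>l. vector l :: gf4 ^ 11) hs)))"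
  using assms
proof (induction hs arbitrary: a)
  case (Cons h hs)
  have "vector (map2 (+) h a) + x = vector a + (vector h + x)" for x :: "gf4 ^ 11"
    using Cons.prems by (simp add: vector_add_11[symmetric] algebra_simps)
  with Cons show ?case by (simp add: filter_map comp_def add.assoc)
qed (simp add: hamming_weight_vector)

subsection \<open>Characters and weights\<close>

text \<open>The sign \<open>(-1)^Tr(a b\<^sup>2)\<close>: the trace form vanishes exactly on dependent pairs over the prime field.\<close>

definition psi :: "gf4 \<Rightarrow> gf4 \<Rightarrow> real" where
  "psi a b = (if a = 0 \<or> b = 0 \<or> a = b then 1 else - 1)"

lemma psi_add_left: "psi (a + b) c = psi a c * psi b c"
  by (cases a; cases b; cases c) (simp_all add: psi_def zero_gf4_def)

lemma psi_commute: "psi a b = psi b a"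
  by (auto simp: psi_def)

lemma UNIV_gf4_constructors: "(UNIV :: gf4 set) = {GF4_0, GF4_1, \<omega>, Omega2}"
  using gf4.exhaust by blast

lemma card_gf4: "CARD(gf4) = 4"
  by (simp add: UNIV_gf4_constructors)

text \<open>A nontrivial character sums to 0 over the whole field; leaving out \<open>a = 0\<close>
  subtracts 1 from the sum.\<close>

lemma sum_psi_nonzero: "(\<Sum>a\<in>- {0}. psi a b) = (if b = 0 then 3 else - 1)"
proof -
  have "- {0} = {GF4_1, \<omega>, Omega2}"
    using UNIV_gf4_constructors by (auto simp: zero_gf4_def)
  then show ?thesis by (cases b) (simp_all add: psi_def zero_gf4_def)
qed

definition chr :: "gf4 ^ 'n \<Rightarrow> gf4 ^ 'n \<Rightarrow> real" where
  "chr x y = (\<Prod>i\<in>UNIV. psi (vec_nth x i) (vec_nth y i))"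

lemma chr_add_left: "chr (x + y) z = chr x z * chr y z"
  by (simp add: chr_def psi_add_left prod.distrib)

lemma chr_commute: "chr x y = chr y x"
  by (simp add: chr_def psi_commute)

lemma chr_add_right: "chr z (x + y) = chr z x * chr z y"
  by (metis chr_add_left chr_commute)

lemma chr_zero_left [simp]: "chr 0 y = 1"
  by (simp add: chr_def psi_def)

lemma chr_zero_right [simp]: "chr x 0 = 1"
  by (simp add: chr_def psi_def)

lemma chr_axis: "chr (axis i a) y = psi a (vec_nth y i)"
proof -
  have "chr (axis i a) y = (\<Prod>j\<in>UNIV. if j = i then psi a (vec_nth y i) else 1)"
    unfolding chr_def by (rule prod.cong) (auto simp: axis_def psi_def)
  then show ?thesis by simp
qed

text \<open>Translating by \<open>x0\<close> permutes \<open>A\<close> but multiplies the sum by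
  \<open>chr x0 y\<close>, which is not 1.\<close>

lemma sum_chr_eq_0:
  assumes "f2.subspace A" "x0 \<in> A" "chr x0 y \<noteq> 1"
  shows "(\<Sum>x\<in>A. chr x y) = 0"
proof -
  have "(\<Sum>x\<in>A. chr x y) = (\<Sum>x\<in>A. chr (x0 + x) y)"
    by (rule sum.reindex_bij_witness[of _ "(+) x0" "(+) x0"])
       (use assms in \<open>auto simp: f2.subspace_add gf4_vec_add_self add.assoc[symmetric]\<close>)
  also have "\<dots> = chr x0 y * (\<Sum>x\<in>A. chr x y)"
    by (simp add: chr_add_left sum_distrib_left)
  finally show ?thesis using assms(3) by simp
qed

lemma card_gf4_vec: "CARD(gf4 ^ 'n) = 4 ^ CARD('n)"
  by (simp add: card_gf4)

lemma sum_chr_UNIV: "(\<Sum>x\<in>UNIV. chr x y) = (if y = 0 then 4 ^ CARD('n) else 0)"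
  for y :: "gf4 ^ 'n"
proof (cases "y = 0")
  case False
  then obtain i where i: "vec_nth y i \<noteq> 0" by (auto simp: vec_eq_iff)
  \<comment> \<open>Any nonzero \<open>a\<close> different from the nonzero coordinate gives the
    sign -1.\<close>
  obtain a where "psi a (vec_nth y i) \<noteq> 1"
  proof -
    have "\<exists>a. psi a (vec_nth y i) \<noteq> 1"
      using i by (cases "vec_nth y i")
        (auto simp: psi_def zero_gf4_def intro: exI[of _ GF4_1] exI[of _ \<omega>])
    with that show ?thesis by blast
  qed
  then have "(\<Sum>x\<in>UNIV. chr x y) = 0"
    by (intro sum_chr_eq_0[of _ "axis i a"]) (simp_all add: chr_axis)
  with False show ?thesis by simp
qed (simp add: card_gf4)

section \<open>Vectors of weight 1 and the neighbour operator\<close>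

definition units :: "(gf4 ^ 'n) set" where
  "units = {e. hamming_weight e = 1}"

lemma hamming_weight_add_axis:
  fixes z :: "gf4 ^ 'n"
  assumes "b \<noteq> 0"
  shows "hamming_weight (z + axis i b) =
    (if vec_nth z i = 0 then hamming_weight z + 1
     else if b = vec_nth z i then hamming_weight z - 1 else hamming_weight z)"
proof -
  let ?S = "{j. vec_nth z j \<noteq> 0}" and ?T = "{j. vec_nth (z + axis i b) j \<noteq> 0}"
  have add0: "x + y = 0 \<longleftrightarrow> x = y" for x y :: gf4
    by (cases x; cases y) (simp_all add: zero_gf4_def)
  have nth: "vec_nth (z + axis i b) j = (if j = i then vec_nth z i + b else vec_nth z j)" for j
    by (simp add: axis_def)
  show ?thesis
  proof (cases "vec_nth z i = 0")
    case True
    then have "?T = insert i ?S" using assms unfolding nth by auto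
    then show ?thesis using True by (simp add: hamming_weight_def)
  next
    case False
    show ?thesis
    proof (cases "b = vec_nth z i")
      case True
      then have "vec_nth z i + b = 0" by (simp only: add0)
      then have "?T = ?S - {i}" unfolding nth by auto
      then show ?thesis using True False by (simp add: hamming_weight_def)
    next
      case neq: False
      then have "vec_nth z i + b \<noteq> 0" by (simp only: add0) simp
      then have "?T = ?S" unfolding nth using False by auto
      then show ?thesis using neq False by (simp add: hamming_weight_def)
    qed
  qed
qed

lemma hamming_weight_0 [simp]: "hamming_weight 0 = 0"
  by (simp add: hamming_weight_def)

lemma hamming_weight_eq_0: "hamming_weight x = 0 \<longleftrightarrow> x = 0"
  by (auto simp: hamming_weight_def vec_eq_iff)

lemma hamming_weight_add_le: "hamming_weight (x + y) \<le> hamming_weight x + hamming_weight y"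
proof -
  have "{i. vec_nth (x + y) i \<noteq> 0} \<subseteq> {i. vec_nth x i \<noteq> 0} \<union> {i. vec_nth y i \<noteq> 0}" by auto
  then show ?thesis unfolding hamming_weight_def
    by (meson card_Un_le card_mono finite le_trans)
qed

lemma bij_betw_units:
  "bij_betw (\<lambda>(i, a). axis i a) (UNIV \<times> - {0}) (units :: (gf4 ^ 'n) set)"
  unfolding bij_betw_def
proof
  show "inj_on (\<lambda>(i :: 'n, a :: gf4). axis i a) (UNIV \<times> - {0})"
    by (auto simp: inj_on_def axis_eq_axis)
  show "(\<lambda>(i, a). axis i a) ` (UNIV \<times> - {0}) = (units :: (gf4 ^ 'n) set)"
  proof (intro equalityI subsetI)
    fix e :: "gf4 ^ 'n"
    assume "e \<in> units"
    then obtain i where i: "{i. vec_nth e i \<noteq> 0} = {i}"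
      by (auto simp: units_def hamming_weight_def card_1_singleton_iff)
    then have "e = axis i (vec_nth e i)" "vec_nth e i \<noteq> 0"
      by (auto simp: vec_eq_iff axis_def)
    then show "e \<in> (\<lambda>(i, a). axis i a) ` (UNIV \<times> - {0})"
      by (intro image_eqI[of _ _ "(i, vec_nth e i)"]) auto
  next
    fix e :: "gf4 ^ 'n"
    assume "e \<in> (\<lambda>(i, a). axis i a) ` (UNIV \<times> - {0})"
    then obtain i a where "e = axis i a" "a \<noteq> 0" by auto
    then show "e \<in> units"
      using hamming_weight_add_axis[of a 0 i] by (simp add: units_def)
  qed
qed

lemma card_units: "card (units :: (gf4 ^ 'n) set) = 3 * CARD('n)"
proof -
  have "card (- {0 :: gf4}) = 3" by (simp add: Compl_eq_Diff_UNIV card_gf4)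
  then show ?thesis
    using bij_betw_same_card[OF bij_betw_units[where 'n = 'n]] by (simp add: card_cartesian_product)
qed

text \<open>The eigenvalue of the Cayley graph with connection set \<open>units\<close> at the
  character of \<open>y\<close>: a zero coordinate contributes 3, a nonzero one -1.\<close>

lemma sum_chr_units:
  "(\<Sum>e\<in>units. chr e y) = 3 * real CARD('n) - 4 * real (hamming_weight y)"
  for y :: "gf4 ^ 'n"
proof -
  have "(\<Sum>e\<in>units. chr e y) = (\<Sum>(i, a)\<in>UNIV \<times> - {0}. psi a (vec_nth y i))"
    using sum.reindex_bij_betw[OF bij_betw_units, of "\<lambda>e. chr e y"]
    by (simp add: chr_axis case_prod_beta)
  also have "\<dots> = (\<Sum>i\<in>UNIV. if vec_nth y i = 0 then 3 else - 1)"
    by (simp add: sum.cartesian_product[symmetric] sum_psi_nonzero)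
  also have "\<dots> = (\<Sum>i\<in>UNIV. 3 - 4 * of_bool (vec_nth y i \<noteq> 0))"
    by (rule sum.cong) auto
  finally show ?thesis
    by (simp add: sum_subtractf sum_distrib_left[symmetric] hamming_weight_def)
qed

lemma card_units_filter:
  fixes z :: "gf4 ^ 'n"
  shows "card {e \<in> units. P (z + e)} = card {(i, a). a \<noteq> 0 \<and> P (z + axis i a)}"
proof (rule bij_betw_same_card[symmetric])
  show "bij_betw (\<lambda>(i, a). axis i a) {(i, a). a \<noteq> 0 \<and> P (z + axis i a)} {e \<in> units. P (z + e)}"
  proof (rule bij_betw_subset[OF bij_betw_units])
    show "(\<lambda>(i, a). axis i a) ` {(i, a). a \<noteq> 0 \<and> P (z + axis i a)} = {e \<in> units. P (z + e)}"
      unfolding bij_betw_imp_surj_on[OF bij_betw_units[where 'n = 'n], symmetric] by force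
  qed auto
qed

text \<open>On each support coordinate exactly one unit, the one cancelling it, lowers the
  weight.\<close>

lemma card_units_weight_decrease:
  fixes z :: "gf4 ^ 'n"
  shows "card {e \<in> units. Suc (hamming_weight (z + e)) = hamming_weight z} = hamming_weight z"
proof -
  \<comment> \<open>This makes the truncated \<open>hamming_weight z - 1\<close> a genuine
    predecessor.\<close>
  have pos: "hamming_weight z > 0" if "vec_nth z i \<noteq> 0" for i
    using that hamming_weight_eq_0[of z] by auto
  have "{(i, a). a \<noteq> 0 \<and> Suc (hamming_weight (z + axis i a)) = hamming_weight z} =
      (\<lambda>i. (i, vec_nth z i)) ` {i. vec_nth z i \<noteq> 0}"
    using pos by (auto simp: hamming_weight_add_axis split: if_splits)
  then show ?thesis
    using card_units_filter[of "\<lambda>x. Suc (hamming_weight x) = hamming_weight z" z]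
    by (simp add: card_image inj_on_def) (simp add: hamming_weight_def)
qed

text \<open>On each support coordinate two of the three nonzero field elements alter the entry
  without cancelling it.\<close>

lemma card_units_weight_same:
  fixes z :: "gf4 ^ 'n"
  shows "card {e \<in> units. hamming_weight (z + e) = hamming_weight z} = 2 * hamming_weight z"
proof -
  have pos: "hamming_weight z > 0" if "vec_nth z i \<noteq> 0" for i
    using that hamming_weight_eq_0[of z] by auto
  have "{(i, a). a \<noteq> 0 \<and> hamming_weight (z + axis i a) = hamming_weight z} =
      Sigma {i. vec_nth z i \<noteq> 0} (\<lambda>i. UNIV - {0, vec_nth z i})"
    using pos by (fastforce simp: hamming_weight_add_axis split: if_splits)
  moreover have "card (UNIV - {0, vec_nth z i}) = 2" if "vec_nth z i \<noteq> 0" for i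
    using that by (auto simp: card_Diff_subset card_gf4)
  ultimately show ?thesis
    using card_units_filter[of "\<lambda>x. hamming_weight x = hamming_weight z" z]
    by simp (simp add: hamming_weight_def)
qed

text \<open>The adjacency operator of the Cayley graph on the whole space. For a code of minimum
  distance 5 it acts on functions constant on cosets as the adjacency operator of the coset
  graph.\<close>

definition nbsum :: "(gf4 ^ 'n \<Rightarrow> real) \<Rightarrow> gf4 ^ 'n \<Rightarrow> real" where
  "nbsum f x = (\<Sum>e\<in>units. f (x + e))"

lemma sum_nbsum: "(\<Sum>x\<in>UNIV. nbsum f x) = card (units :: (gf4 ^ 'n) set) * (\<Sum>x\<in>UNIV. f x)"
  for f :: "gf4 ^ 'n \<Rightarrow> real"
proof -
  have "(\<Sum>x\<in>UNIV. f (x + e)) = (\<Sum>x\<in>UNIV. f x)" for e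
    by (rule sum.reindex_bij_witness[of _ "\<lambda>x. x - e" "\<lambda>x. x + e"]) auto
  then show ?thesis
    unfolding nbsum_def by (subst sum.swap) simp
qed

section \<open>Fourier expansion over a code and its dual\<close>

locale dual_codes =
  fixes C Y :: "(gf4 ^ 'n) set"
  assumes subspace_C: "f2.subspace C"
    and subspace_Y: "f2.subspace Y"
    and orthogonal: "\<And>x y. x \<in> C \<Longrightarrow> y \<in> Y \<Longrightarrow> chr x y = 1"
    and card_C_Y: "card C * card Y = 4 ^ CARD('n)"
begin

lemma card_Y_pos: "card Y > 0"
  using card_C_Y by (metis gr0I mult_0_right power_not_zero zero_neq_numeral)

text \<open>The point is that \<open>C\<close> is the full annihilator \<open>P\<close> of
  \<open>Y\<close>. Summing \<open>chr x y\<close> over all \<open>x\<close> and all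
  \<open>y\<close> in \<open>Y\<close> in both orders gives
  \<open>card P * card Y = card C * card Y\<close>, and \<open>C\<close> is contained in
  \<open>P\<close>.\<close>

lemma sum_chr_Y: "(\<Sum>y\<in>Y. chr x y) = (if x \<in> C then real (card Y) else 0)"
proof -
  define P where "P = {x. \<forall>y\<in>Y. chr x y = 1}"
  have sum_Y: "(\<Sum>y\<in>Y. chr x y) = (if x \<in> P then real (card Y) else 0)" for x
  proof (cases "x \<in> P")
    case False
    then obtain y0 where "y0 \<in> Y" "chr x y0 \<noteq> 1" by (auto simp: P_def)
    with sum_chr_eq_0[OF subspace_Y, of y0 x] False show ?thesis by (simp add: chr_commute)
  qed (simp add: P_def)
  have "real (card P * card Y) = (\<Sum>x\<in>UNIV. \<Sum>y\<in>Y. chr x y)"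
    by (simp add: sum_Y sum.If_cases)
  also have "\<dots> = (\<Sum>y\<in>Y. \<Sum>x\<in>UNIV. chr x y)" by (rule sum.swap)
  also have "\<dots> = real (card C * card Y)"
    using f2.subspace_0[OF subspace_Y] unfolding card_C_Y by (simp add: sum_chr_UNIV)
  finally have "card P = card C" using card_Y_pos by (simp only: of_nat_eq_iff) auto
  moreover have "C \<subseteq> P" using orthogonal by (auto simp: P_def)
  ultimately have "C = P" by (intro card_subset_eq) auto
  with sum_Y show ?thesis by simp
qed

definition eigval :: "gf4 ^ 'n \<Rightarrow> real" where
  "eigval y = 3 * real CARD('n) - 4 * real (hamming_weight y)"

text \<open>The indicator of \<open>C\<close> is the average of the characters from
  \<open>Y\<close>, and each of them is an eigenfunction of \<open>nbsum\<close>.\<close>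

lemma nbsum_power_indicator:
  "(nbsum ^^ k) (\<lambda>x. of_bool (x \<in> C)) x = (\<Sum>y\<in>Y. eigval y ^ k * chr x y) / card Y"
proof (induction k arbitrary: x)
  case 0
  show ?case using card_Y_pos by (auto simp: sum_chr_Y card_gt_0_iff)
next
  case (Suc k)
  have "(nbsum ^^ Suc k) (\<lambda>x. of_bool (x \<in> C)) x =
      (\<Sum>e\<in>units. (\<Sum>y\<in>Y. eigval y ^ k * chr (x + e) y) / card Y)"
    by (simp add: nbsum_def Suc)
  also have "\<dots> = (\<Sum>y\<in>Y. eigval y ^ k * chr x y * (\<Sum>e\<in>units. chr e y)) / card Y"
    unfolding sum_divide_distrib[symmetric]
    by (subst sum.swap) (simp add: chr_add_left sum_distrib_left mult.assoc)
  finally show ?case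
    by (simp add: sum_chr_units eigval_def mult_ac)
qed

end

subsection \<open>Coset weights and codes of minimum distance 5\<close>

text \<open>The weight of a coset leader; it will turn out to be the graph distance between cosets
  that differ by \<open>x\<close>.\<close>

definition coset_weight :: "(gf4 ^ 'n) set \<Rightarrow> gf4 ^ 'n \<Rightarrow> nat" where
  "coset_weight C x = (LEAST k. \<exists>c\<in>C. hamming_weight (x + c) = k)"

locale additive_code =
  fixes C :: "(gf4 ^ 'n) set"
  assumes subspace: "f2.subspace C"
begin

abbreviation D where "D \<equiv> coset_weight C"

lemma zero_mem [simp]: "0 \<in> C"
  using f2.subspace_0[OF subspace] .

lemma add_mem: "a \<in> C \<Longrightarrow> b \<in> C \<Longrightarrow> a + b \<in> C"
  using f2.subspace_add[OF subspace] .

lemma add_mem_iff: "a \<in> C \<Longrightarrow> x + a \<in> C \<longleftrightarrow> x \<in> C"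
  using add_mem[of x a] add_mem[of "x + a" a] by (auto simp: add.assoc gf4_vec_add_self)

lemma coset_weight_attained: obtains c where "c \<in> C" "hamming_weight (x + c) = D x"
proof -
  have "\<exists>k. \<exists>c\<in>C. hamming_weight (x + c) = k" using zero_mem by blast
  from LeastI_ex[OF this] show thesis using that unfolding coset_weight_def by blast
qed

lemma coset_weight_le: "c \<in> C \<Longrightarrow> D x \<le> hamming_weight (x + c)"
  unfolding coset_weight_def by (rule Least_le) blast

lemma coset_weight_le_weight: "D x \<le> hamming_weight x"
  using coset_weight_le[of 0 x] by simp

lemma coset_weight_add_mem:
  assumes "c \<in> C"
  shows "D (x + c) = D x"
proof -
  have le: "D (x + c) \<le> D x" if "c \<in> C" for x c
  proof -
    obtain c' where c': "c' \<in> C" "hamming_weight (x + c') = D x" by (rule coset_weight_attained)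
    have "x + c + (c + c') = x + (c + c) + c'" by (simp only: add.assoc)
    then have "x + c + (c + c') = x + c'" by (simp only: gf4_vec_add_self add_0_right)
    with coset_weight_le[OF add_mem[OF that c'(1)], of "x + c"] c'(2) show ?thesis by simp
  qed
  have "x + c + c = x" by (simp add: add.assoc gf4_vec_add_self)
  with le[OF assms, of x] le[OF assms, of "x + c"] show ?thesis by simp
qed

lemma coset_weight_eq_0_iff: "D x = 0 \<longleftrightarrow> x \<in> C"
proof
  assume "D x = 0"
  then obtain c where "c \<in> C" "x + c = 0"
    by (metis coset_weight_attained hamming_weight_eq_0)
  then show "x \<in> C" using add_mem_iff[of c x] by simp
next
  assume "x \<in> C"
  then show "D x = 0" using coset_weight_le[of x x] by (simp add: gf4_vec_add_self)
qed

lemma coset_weight_add_unit_le: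
  assumes "e \<in> units"
  shows "D (x + e) \<le> Suc (D x)"
proof -
  obtain c where "c \<in> C" "hamming_weight (x + c) = D x" by (rule coset_weight_attained)
  then show ?thesis
    using coset_weight_le[of c "x + e"] hamming_weight_add_le[of "x + c" e] assms
    by (simp add: units_def add_ac)
qed

lemma coset_weight_le_add_unit:
  assumes "e \<in> units"
  shows "D x \<le> Suc (D (x + e))"
  using coset_weight_add_unit_le[OF assms, of "x + e"] by (simp add: add.assoc gf4_vec_add_self)

text \<open>Cancel one support coordinate of a coset leader. This supplies the first step of a
  geodesic.\<close>

lemma coset_weight_Suc_decrease:
  assumes "D x = Suc k"
  obtains e where "e \<in> units" "D (x + e) = k"
proof -
  obtain c where c: "c \<in> C" "hamming_weight (x + c) = D x" by (rule coset_weight_attained)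
  have "card {e \<in> units. Suc (hamming_weight (x + c + e)) = hamming_weight (x + c)} \<noteq> 0"
    using card_units_weight_decrease[of "x + c"] c(2) assms by linarith
  then have "{e \<in> units. Suc (hamming_weight (x + c + e)) = Suc k} \<noteq> {}"
    unfolding c(2) assms by (metis card.empty)
  then obtain e where e: "e \<in> units" "Suc (hamming_weight (x + c + e)) = Suc k" by blast
  then have "D (x + e) \<le> k" using coset_weight_le[OF c(1), of "x + e"] by (simp add: add_ac)
  with coset_weight_le_add_unit[OF e(1), of x] assms have "D (x + e) = k" by simp
  with e(1) that show thesis by blast
qed

text \<open>These become the intersection numbers once they are known to depend on
  \<open>D x\<close> alone.\<close>

definition nb_count :: "gf4 ^ 'n \<Rightarrow> nat \<Rightarrow> nat" where
  "nb_count x j = card {e \<in> units. D (x + e) = j}"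

lemma nb_count_add_mem:
  assumes "c \<in> C"
  shows "nb_count (x + c) j = nb_count x j"
proof -
  have "D (x + c + e) = D (x + e)" for e
    using coset_weight_add_mem[OF assms, of "x + e"] by (simp add: ac_simps)
  then show ?thesis by (simp add: nb_count_def)
qed

lemma nb_count_eq_0: "Suc j < D x \<Longrightarrow> nb_count x j = 0"
  unfolding nb_count_def using coset_weight_le_add_unit[of _ x] by (fastforce simp: card_eq_0_iff)

text \<open>Yields the last unknown count at a vertex when the others are known.\<close>

lemma sum_nb_count:
  assumes "finite J" "\<And>e. e \<in> units \<Longrightarrow> D (x + e) \<in> J"
  shows "(\<Sum>j\<in>J. nb_count x j) = 3 * CARD('n)"
proof -
  have "units = (\<Union>j\<in>J. {e \<in> units. D (x + e) = j})" using assms(2) by blast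
  then have "card (units :: (gf4 ^ 'n) set) = card (\<Union>j\<in>J. {e \<in> units. D (x + e) = j})" by simp
  also have "\<dots> = (\<Sum>j\<in>J. nb_count x j)"
    unfolding nb_count_def using assms(1) by (intro card_UN_disjoint) auto
  finally show ?thesis by (simp add: card_units)
qed

lemma nbsum_of_bool_coset_weight: "nbsum (\<lambda>x. of_bool (D x = j)) x = real (nb_count x j)"
  unfolding nbsum_def nb_count_def by (simp add: Int_def conj_commute)

end

section \<open>Codes of minimum distance 5\<close>

locale distance_5_code = additive_code C for C :: "(gf4 ^ 'n) set" +
  assumes min_distance: "\<And>c. c \<in> C \<Longrightarrow> c \<noteq> 0 \<Longrightarrow> hamming_weight c \<ge> 5"
begin

text \<open>The vector \<open>x\<close> and a leader of its coset differ by a codeword of weight at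
  most 4, hence by 0.\<close>

lemma coset_weight_eq_weight:
  assumes "hamming_weight x + D x \<le> 4"
  shows "D x = hamming_weight x"
proof -
  obtain c where c: "c \<in> C" "hamming_weight (x + c) = D x" by (rule coset_weight_attained)
  have "c = x + (x + c)" by (simp add: add.assoc[symmetric] gf4_vec_add_self)
  then have "hamming_weight c \<le> 4"
    using hamming_weight_add_le[of x "x + c"] c(2) assms by simp
  then have "c = 0" using min_distance[OF c(1)] by force
  with c(2) show ?thesis by simp
qed

text \<open>Passing to a coset leader allows the neighbour counts to be made in Hamming
  space.\<close>

lemma nb_count_representative:
  obtains z where "hamming_weight z = D x" "D z = D x" "\<And>j. nb_count z j = nb_count x j"
proof -
  obtain c where c: "c \<in> C" "hamming_weight (x + c) = D x" by (rule coset_weight_attained)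
  with that[of "x + c"] show thesis by (simp add: coset_weight_add_mem nb_count_add_mem)
qed

text \<open>The weight of \<open>z + e\<close> is at most \<open>hamming_weight z + 1\<close>, so
  together with \<open>j\<close> it stays within the bound 4 of
  \<open>coset_weight_eq_weight\<close>.\<close>

lemma nb_count_eq_weight_count:
  assumes "hamming_weight z + j \<le> 3"
  shows "nb_count z j = card {e \<in> units. hamming_weight (z + e) = j}"
proof -
  have "D (z + e) = j \<longleftrightarrow> hamming_weight (z + e) = j" if "e \<in> units" for e
    using coset_weight_eq_weight[of "z + e"] hamming_weight_add_le[of z e] that assms
      coset_weight_le_weight[of "z + e"]
    by (auto simp: units_def)
  then have "{e \<in> units. D (z + e) = j} = {e \<in> units. hamming_weight (z + e) = j}" by blast
  then show ?thesis by (simp add: nb_count_def)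
qed

lemma nb_count_0: "nb_count x 0 = of_bool (D x = 1)"
proof -
  obtain z where z: "hamming_weight z = D x" "D z = D x" "\<And>j. nb_count z j = nb_count x j"
    by (rule nb_count_representative[of x]) blast
  consider "D x = 0" | "D x = 1" | "D x \<ge> 2" by linarith
  then show ?thesis
  proof cases
    case 1
    then have "z = 0" using z by (simp add: hamming_weight_eq_0)
    moreover have "{e \<in> units. hamming_weight e = 0} = {}" by (auto simp: units_def)
    ultimately show ?thesis using 1 z nb_count_eq_weight_count[of z 0] by simp
  next
    case 2
    with z nb_count_eq_weight_count[of z 0] card_units_weight_decrease[of z] show ?thesis by simp
  next
    case 3
    then show ?thesis using nb_count_eq_0[of 0 x] by simp
  qed
qed

text \<open>The values are the coefficients of the square of the adjacency matrix in terms of the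
  distance matrices. At a leader of weight 1 two units keep the weight; at one of weight 2 two units
  lower it.\<close>

lemma nb_count_1: "nb_count x 1 = (if D x = 0 then 3 * CARD('n) else if D x \<le> 2 then 2 else 0)"
proof -
  obtain z where z: "hamming_weight z = D x" "D z = D x" "\<And>j. nb_count z j = nb_count x j"
    by (rule nb_count_representative[of x]) blast
  consider "D x = 0" | "D x = 1" | "D x = 2" | "D x > 2" by linarith
  then show ?thesis
  proof cases
    case 1
    then have "z = 0" using z by (simp add: hamming_weight_eq_0)
    moreover have "{e \<in> units. hamming_weight e = 1} = (units :: (gf4 ^ 'n) set)"
      by (auto simp: units_def)
    ultimately show ?thesis
      using 1 z nb_count_eq_weight_count[of z 1] card_units[where 'n = 'n] by simp
  next
    case 2
    with z nb_count_eq_weight_count[of z 1] card_units_weight_same[of z] show ?thesis by simp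
  next
    case 3
    with z nb_count_eq_weight_count[of z 1] card_units_weight_decrease[of z] show ?thesis
      by (simp add: eval_nat_numeral)
  next
    case 4
    then show ?thesis using nb_count_eq_0[of 1 x] by simp
  qed
qed

lemma nbsum_1: "nbsum (\<lambda>x. of_bool (x \<in> C)) x = of_bool (D x = 1)"
  using nbsum_of_bool_coset_weight[of 0 x] nb_count_0 by (simp add: coset_weight_eq_0_iff)

lemma nbsum_2: "(nbsum ^^ 2) (\<lambda>x. of_bool (x \<in> C)) x = real (nb_count x 1)"
proof -
  have "nbsum (\<lambda>x. of_bool (x \<in> C)) = (\<lambda>x. of_bool (D x = 1))" using nbsum_1 by blast
  then show ?thesis by (simp add: numeral_2_eq_2 nbsum_of_bool_coset_weight)
qed

text \<open>Apply \<open>nbsum\<close> once more to the values in \<open>nb_count_1\<close>. The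
  unknown \<open>nb_count x 2\<close> enters here and is later solved for by the cubic
  relation.\<close>

lemma nbsum_3:
  "(nbsum ^^ 3) (\<lambda>x. of_bool (x \<in> C)) x =
    3 * real CARD('n) * real (nb_count x 0) + 2 * real (nb_count x 1) + 2 * real (nb_count x 2)"
proof -
  have "(nbsum ^^ 2) (\<lambda>x. of_bool (x \<in> C)) = (\<lambda>x. real (nb_count x 1))" using nbsum_2 by blast
  then have "(nbsum ^^ 3) (\<lambda>x. of_bool (x \<in> C)) x = nbsum (\<lambda>x. real (nb_count x 1)) x"
    by (simp add: numeral_3_eq_3 numeral_2_eq_2)
  also have "\<dots> = (\<Sum>e\<in>units. 3 * real CARD('n) * of_bool (D (x + e) = 0) + 2 * of_bool (D (x + e) = 1)
      + 2 * of_bool (D (x + e) = 2))"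
    unfolding nbsum_def nb_count_1 by (rule sum.cong) auto
  also have "\<dots> = 3 * real CARD('n) * nbsum (\<lambda>x. of_bool (D x = 0)) x + 2 * nbsum (\<lambda>x. of_bool (D x = 1)) x
      + 2 * nbsum (\<lambda>x. of_bool (D x = 2)) x"
    unfolding nbsum_def by (simp only: sum.distrib sum_distrib_left)
  finally show ?thesis unfolding nbsum_of_bool_coset_weight .
qed

text \<open>Sum \<open>nbsum_1\<close> over all vectors: \<open>nbsum\<close> multiplies a total by
  the number of units.\<close>

lemma card_coset_weight_1: "card {x. D x = 1} = 3 * CARD('n) * card C"
proof -
  have "real (card {x. D x = 1}) = (\<Sum>x\<in>UNIV. nbsum (\<lambda>x. of_bool (x \<in> C)) x)"
    by (simp add: nbsum_1)
  also have "\<dots> = real (3 * CARD('n) * card C)"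
    unfolding sum_nbsum by (simp add: card_units)
  finally show ?thesis by (simp only: of_nat_eq_iff)
qed

text \<open>Evaluate the sum of \<open>nb_count x 1\<close> over all \<open>x\<close> twice, by
  \<open>sum_nbsum\<close> and by \<open>nb_count_1\<close>. The additive form avoids subtraction of
  naturals.\<close>

lemma card_coset_weight_2:
  "2 * card {x. D x = 2} + 9 * CARD('n) * card C = 9 * CARD('n) ^ 2 * card C"
proof -
  have "(\<Sum>x\<in>UNIV. real (nb_count x 1)) = (\<Sum>x\<in>UNIV. nbsum (\<lambda>x. of_bool (D x = 1)) x)"
    unfolding nbsum_of_bool_coset_weight ..
  also have "\<dots> = 3 * CARD('n) * real (card {x. D x = 1})"
    unfolding sum_nbsum by (simp add: card_units)
  finally have *: "(\<Sum>x\<in>UNIV. real (nb_count x 1)) = 9 * CARD('n) ^ 2 * card C"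
    unfolding card_coset_weight_1 by (simp add: power2_eq_square)
  have "(\<Sum>x\<in>UNIV. real (nb_count x 1)) = (\<Sum>x\<in>UNIV. 3 * real CARD('n) * of_bool (D x = 0) + 2 * of_bool (D x = 1)
      + 2 * of_bool (D x = 2))"
    unfolding nb_count_1 by (rule sum.cong) auto
  also have "\<dots> = 3 * CARD('n) * card C + 2 * card {x. D x = 1} + 2 * card {x. D x = 2}"
    by (simp add: sum.distrib sum_distrib_left[symmetric] coset_weight_eq_0_iff)
  finally have "real (2 * card {x. D x = 2} + 9 * CARD('n) * card C) = real (9 * CARD('n) ^ 2 * card C)"
    unfolding * card_coset_weight_1 by simp
  then show ?thesis by (simp only: of_nat_eq_iff)
qed

end

subsection \<open>The coset graph\<close>

context additive_code
begin

lemma coset_weight_triangle: "D (x + y) \<le> D x + D y"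
proof -
  obtain c where c: "c \<in> C" "hamming_weight (x + c) = D x" by (rule coset_weight_attained)
  obtain c' where c': "c' \<in> C" "hamming_weight (y + c') = D y" by (rule coset_weight_attained)
  show ?thesis
    using coset_weight_le[OF add_mem[OF c(1) c'(1)], of "x + y"]
      hamming_weight_add_le[of "x + c" "y + c'"] c(2) c'(2)
    by (simp add: ac_simps)
qed

lemma mem_coset_iff: "w \<in> coset x C \<longleftrightarrow> x + w \<in> C"
proof
  assume "w \<in> coset x C"
  then show "x + w \<in> C" by (auto simp: coset_def gf4_vec_add_left_self)
next
  assume "x + w \<in> C"
  moreover have "w = x + (x + w)" by (simp add: gf4_vec_add_left_self)
  ultimately show "w \<in> coset x C" unfolding coset_def by blast
qed

lemma coset_eq_iff: "coset x C = coset y C \<longleftrightarrow> x + y \<in> C"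
proof
  assume "coset x C = coset y C"
  then have "y \<in> coset x C" by (simp add: mem_coset_iff gf4_vec_add_self)
  then show "x + y \<in> C" by (simp add: mem_coset_iff)
next
  assume *: "x + y \<in> C"
  have "x + w \<in> C \<longleftrightarrow> y + w \<in> C" for w
    using add_mem_iff[OF *, of "x + w"] by (simp add: gf4_vec_ac)
  then show "coset x C = coset y C" by (auto simp: mem_coset_iff)
qed

text \<open>A set closed under translation by \<open>C\<close> is a disjoint union of cosets, all of
  size \<open>card C\<close>.\<close>

lemma card_eq_card_cosets:
  assumes "\<And>x c. x \<in> B \<Longrightarrow> c \<in> C \<Longrightarrow> x + c \<in> B"
  shows "card B = card C * card ((\<lambda>x. coset x C) ` B)"
proof -
  have "card C * card ((\<lambda>x. coset x C) ` B) = card (\<Union> ((\<lambda>x. coset x C) ` B))"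
  proof (rule card_partition)
    show "card X = card C" if "X \<in> (\<lambda>x. coset x C) ` B" for X
    proof -
      obtain x where "X = (+) x ` C" using \<open>X \<in> _\<close> by (auto simp: coset_def)
      then show ?thesis by (simp add: card_image)
    qed
    show "X \<inter> X' = {}" if X: "X \<in> (\<lambda>x. coset x C) ` B" "X' \<in> (\<lambda>x. coset x C) ` B" "X \<noteq> X'" for X X'
    proof (rule ccontr)
      assume "X \<inter> X' \<noteq> {}"
      then obtain w where "w \<in> X" "w \<in> X'" by blast
      have "Z = coset w C" if "Z \<in> (\<lambda>x. coset x C) ` B" "w \<in> Z" for Z
        using that coset_eq_iff mem_coset_iff by blast
      with X(1,2) \<open>w \<in> X\<close> \<open>w \<in> X'\<close> have "X = coset w C" "X' = coset w C" by blast+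
      with X(3) show False by simp
    qed
  qed auto
  moreover have "\<Union> ((\<lambda>x. coset x C) ` B) = B"
  proof
    show "B \<subseteq> \<Union> ((\<lambda>x. coset x C) ` B)" by (auto simp: mem_coset_iff gf4_vec_add_self)
    show "\<Union> ((\<lambda>x. coset x C) ` B) \<subseteq> B" using assms by (auto simp: coset_def)
  qed
  ultimately show ?thesis by simp
qed

lemma pverts_coset_graph: "pverts (coset_graph C) = range (\<lambda>x. coset x C)"
  by (auto simp: coset_graph_def)

lemma parcs_coset_graph_iff:
  "(U, V) \<in> parcs (coset_graph C) \<longleftrightarrow>
    U \<in> pverts (coset_graph C) \<and> V \<in> pverts (coset_graph C) \<and> (\<exists>u\<in>U. \<exists>v\<in>V. u - v \<in> units)"
  by (auto simp: coset_graph_def units_def)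

end

section \<open>Distances, spheres and neighbours in the coset graph\<close>

context distance_5_code
begin

lemma coset_weight_unit: "e \<in> units \<Longrightarrow> D e = 1"
  using coset_weight_eq_weight[of e] coset_weight_le_weight[of e] by (simp add: units_def)

lemma coset_weight_1_iff: "D x = 1 \<longleftrightarrow> (\<exists>e\<in>units. x + e \<in> C)"
proof -
  have "D x = 1 \<longleftrightarrow> nb_count x 0 \<noteq> 0" by (simp add: nb_count_0)
  also have "\<dots> \<longleftrightarrow> (\<exists>e\<in>units. x + e \<in> C)"
    by (auto simp: nb_count_def card_eq_0_iff coset_weight_eq_0_iff)
  finally show ?thesis .
qed

lemma coset_adjacent_iff:
  "(coset x C, coset y C) \<in> parcs (coset_graph C) \<longleftrightarrow> D (x + y) = 1"
proof
  assume "(coset x C, coset y C) \<in> parcs (coset_graph C)"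
  then obtain u v where uv: "x + u \<in> C" "y + v \<in> C" "u - v \<in> units"
    by (auto simp: parcs_coset_graph_iff mem_coset_iff)
  have "x + y + (u - v) = (x + u) + (y + v)" by (simp add: gf4_vec_diff_eq_add ac_simps)
  then have "x + y + (u - v) \<in> C" by (simp only: add_mem[OF uv(1,2)])
  with uv(3) show "D (x + y) = 1" unfolding coset_weight_1_iff by blast
next
  assume "D (x + y) = 1"
  then obtain e where e: "e \<in> units" "x + y + e \<in> C" unfolding coset_weight_1_iff by blast
  have "x \<in> coset x C" "x + e \<in> coset y C" "x - (x + e) \<in> units"
    using e by (simp_all add: mem_coset_iff gf4_vec_diff_eq_add gf4_vec_ac)
  then show "(coset x C, coset y C) \<in> parcs (coset_graph C)"
    unfolding parcs_coset_graph_iff pverts_coset_graph by blast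
qed

lemma pair_graph_coset_graph: "pair_graph (coset_graph C)"
proof
  show "symmetric (with_proj (coset_graph C))"
  proof -
    have "(b, a) \<in> parcs (coset_graph C)" if ab: "(a, b) \<in> parcs (coset_graph C)" for a b
    proof -
      obtain x y where "a = coset x C" "b = coset y C"
        using ab by (auto simp: parcs_coset_graph_iff pverts_coset_graph)
      with ab show ?thesis by (simp add: coset_adjacent_iff add.commute)
    qed
    then show ?thesis by (auto simp: symmetric_def sym_def)
  qed
  show "fst e \<noteq> snd e" if e: "e \<in> parcs (coset_graph C)" for e
  proof -
    obtain x y where "e = (coset x C, coset y C)"
      using e by (cases e) (auto simp: parcs_coset_graph_iff pverts_coset_graph)
    with e coset_weight_eq_0_iff[of "x + y"] show ?thesis
      by (simp add: coset_adjacent_iff coset_eq_iff)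
  qed
qed (auto simp: coset_graph_def)

text \<open>The triangle inequality along a walk shows that no walk is shorter than
  \<open>D (x + y)\<close>; lowering the coset weight one unit at a time builds a walk of that
  length.\<close>

lemma graph_dist_coset_graph: "graph_dist (coset_graph C) (coset x C) (coset y C) = ereal (D (x + y))"
proof -
  interpret pair_graph "coset_graph C" by (rule pair_graph_coset_graph)
  have le: "D (x + y) \<le> length p" if "awalk (coset x C) p (coset y C)" for p
    using that
  proof (induction p arbitrary: x)
    case Nil
    then show ?case by (simp add: awalk_Nil_iff coset_eq_iff coset_weight_eq_0_iff)
  next
    case (Cons a p)
    then have "a \<in> parcs (coset_graph C)" "fst a = coset x C" "awalk (snd a) p (coset y C)"
      by (auto simp: awalk_Cons_iff)
    moreover then obtain z where z: "snd a = coset z C"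
      by (cases a) (auto simp: parcs_coset_graph_iff pverts_coset_graph)
    ultimately have "D (x + z) = 1" "D (z + y) \<le> length p"
      using Cons.IH by (cases a, auto simp: coset_adjacent_iff)+
    moreover have "x + y = (x + z) + (z + y)" by (simp add: gf4_vec_ac)
    ultimately show ?case using coset_weight_triangle[of "x + z" "z + y"] by simp
  qed
  have ex: "\<exists>p. awalk (coset x C) p (coset y C) \<and> length p = k" if "D (x + y) = k" for k
    using that
  proof (induction k arbitrary: x)
    case 0
    then have "coset x C = coset y C" by (simp add: coset_weight_eq_0_iff coset_eq_iff)
    then have "awalk (coset x C) [] (coset y C)"
      by (simp add: awalk_Nil_iff pverts_coset_graph)
    then show ?case by auto
  next
    case (Suc k)
    obtain e where e: "e \<in> units" "D (x + y + e) = k"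
      using Suc.prems by (rule coset_weight_Suc_decrease)
    then have "D ((x + e) + y) = k" by (simp add: ac_simps)
    then obtain p where p: "awalk (coset (x + e) C) p (coset y C)" "length p = k"
      using Suc.IH by blast
    have "(coset x C, coset (x + e) C) \<in> parcs (coset_graph C)"
      using coset_weight_unit[OF e(1)] by (simp add: coset_adjacent_iff gf4_vec_add_left_self)
    with p have "awalk (coset x C) ((coset x C, coset (x + e) C) # p) (coset y C)"
      by (simp add: awalk_Cons_iff)
    with p(2) show ?case by (metis length_Cons)
  qed
  have cost: "awalk_cost (\<lambda>_. 1) p = length p" for p
    by (induction p) simp_all
  show ?thesis
    unfolding graph_dist_def
  proof (rule antisym)
    obtain p where "awalk (coset x C) p (coset y C)" "length p = D (x + y)" using ex by blast
    then show "\<mu> (\<lambda>_. 1) (coset x C) (coset y C) \<le> ereal (D (x + y))"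
      using min_cost_le_walk_cost[of "coset x C" p "coset y C" "\<lambda>_. 1"] by (simp add: cost)
    show "ereal (D (x + y)) \<le> \<mu> (\<lambda>_. 1) (coset x C) (coset y C)"
      unfolding \<mu>_def by (rule INF_greatest) (simp add: cost le)
  qed
qed

text \<open>All distances are finite, and finite distance means reachability.\<close>

lemma connected_coset_graph: "Digraph_Component.connected (with_proj (coset_graph C))"
proof -
  interpret pair_graph "coset_graph C" by (rule pair_graph_coset_graph)
  have "u \<rightarrow>\<^sup>*\<^bsub>with_proj (coset_graph C)\<^esub> v" if uv: "u \<in> pverts (coset_graph C)" "v \<in> pverts (coset_graph C)" for u v
  proof -
    obtain x y where "u = coset x C" "v = coset y C" using uv by (auto simp: pverts_coset_graph)
    then have "\<mu> (\<lambda>_. 1) u v < \<infinity>"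
      using graph_dist_coset_graph[of x y] by (simp add: graph_dist_def)
    then show ?thesis by (simp only: \<mu>_reach_conv)
  qed
  then show ?thesis
    unfolding Digraph_Component.connected_def strongly_connected_def
    using reachable_mk_symmetric_eq[OF pair_sym_arcs] by (auto simp: pverts_coset_graph)
qed

lemma sphere_at_coset_graph:
  "sphere_at (coset_graph C) (coset x C) i = (\<lambda>y. coset y C) ` {y. D (x + y) = i}"
  by (auto simp: sphere_at_def pverts_coset_graph graph_dist_coset_graph)

text \<open>Translation by \<open>x\<close> moves the centre to 0, and the preimage of a sphere is a
  union of cosets.\<close>

lemma card_sphere_at: "card {z. D z = i} = card C * card (sphere_at (coset_graph C) (coset x C) i)"
proof -
  have "card {z. D z = i} = card {y. D (x + y) = i}"
    by (rule bij_betw_same_card[of "(+) x"], rule bij_betw_byWitness[of _ "(+) x"])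
       (auto simp: gf4_vec_add_left_self)
  also have "\<dots> = card C * card (sphere_at (coset_graph C) (coset x C) i)"
    unfolding sphere_at_coset_graph
  proof (rule card_eq_card_cosets)
    fix y c assume "y \<in> {y. D (x + y) = i}" "c \<in> C"
    then show "y + c \<in> {y. D (x + y) = i}"
      using coset_weight_add_mem[of c "x + y"] by (simp add: ac_simps)
  qed
  finally show ?thesis .
qed

text \<open>Two units differ by a vector of weight at most 2, which is in \<open>C\<close> only if
  it is 0. Hence counting neighbours is counting units.\<close>

lemma coset_add_unit_inj: "inj_on (\<lambda>e. coset (y + e) C) units"
proof (rule inj_onI)
  fix e e' :: "gf4 ^ 'n"
  assume e: "e \<in> units" "e' \<in> units" and "coset (y + e) C = coset (y + e') C"
  then have "e + e' \<in> C" by (simp add: coset_eq_iff gf4_vec_ac)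
  moreover have "hamming_weight (e + e') \<le> 2"
    using hamming_weight_add_le[of e e'] e by (simp add: units_def)
  ultimately have "e + e' = 0" using min_distance by force
  then show "e = e'" by (metis add.right_neutral gf4_vec_add_left_self)
qed

lemma neighbours_coset_graph:
  "neighbours (coset_graph C) (coset y C) = (\<lambda>e. coset (y + e) C) ` units"
proof (intro equalityI subsetI)
  fix W assume W: "W \<in> neighbours (coset_graph C) (coset y C)"
  then obtain z where z: "W = coset z C" by (auto simp: neighbours_def parcs_coset_graph_iff pverts_coset_graph)
  with W obtain e where "e \<in> units" "y + z + e \<in> C"
    by (auto simp: neighbours_def coset_adjacent_iff coset_weight_1_iff simp del: One_nat_def)
  with z show "W \<in> (\<lambda>e. coset (y + e) C) ` units"
    by (intro image_eqI[of _ _ e]) (simp_all add: coset_eq_iff ac_simps)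
next
  fix W assume "W \<in> (\<lambda>e. coset (y + e) C) ` units"
  then show "W \<in> neighbours (coset_graph C) (coset y C)"
    using coset_weight_unit by (auto simp: neighbours_def coset_adjacent_iff gf4_vec_add_left_self)
qed

lemma card_neighbours_sphere:
  "card (neighbours (coset_graph C) (coset y C) \<inter> sphere_at (coset_graph C) (coset x C) j) =
    nb_count (x + y) j"
proof -
  have "coset (y + e) C \<in> sphere_at (coset_graph C) (coset x C) j \<longleftrightarrow> D (x + y + e) = j" for e
    by (simp add: sphere_at_def pverts_coset_graph graph_dist_coset_graph add.assoc)
  then have "neighbours (coset_graph C) (coset y C) \<inter> sphere_at (coset_graph C) (coset x C) j =
      (\<lambda>e. coset (y + e) C) ` {e \<in> units. D (x + y + e) = j}"
    unfolding neighbours_coset_graph by auto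
  moreover have "inj_on (\<lambda>e. coset (y + e) C) {e \<in> units. D (x + y + e) = j}"
    using coset_add_unit_inj by (rule inj_on_subset) auto
  ultimately show ?thesis by (simp add: nb_count_def card_image)
qed

text \<open>A row of the adjacency matrix applied to a function on cosets, pulled back to
  vectors.\<close>

lemma sum_adjacent:
  assumes "\<And>z. g (coset z C) = f z"
  shows "(\<Sum>W\<in>pverts (coset_graph C).
      (if (coset x C, W) \<in> parcs (coset_graph C) then 1 else 0) * g W) = nbsum f x"
proof -
  have "(\<Sum>W\<in>pverts (coset_graph C).
      (if (coset x C, W) \<in> parcs (coset_graph C) then 1 else 0) * g W) =
      (\<Sum>W\<in>neighbours (coset_graph C) (coset x C). g W)"
    by (rule sum.mono_neutral_cong_right)
       (auto simp: neighbours_def parcs_coset_graph_iff pverts_coset_graph)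
  also have "\<dots> = nbsum f x"
    unfolding neighbours_coset_graph nbsum_def
    by (subst sum.reindex[OF coset_add_unit_inj]) (simp add: assms)
  finally show ?thesis .
qed

end

subsection \<open>The spectrum\<close>

text \<open>The columns of \<open>P\<close> are eigenvectors. The left inverse \<open>Q\<close> of a
  square matrix is two-sided, so \<open>A\<close> is similar to the diagonal matrix
  \<open>B\<close>, whose characteristic polynomial splits visibly.\<close>

lemma proots_char_poly_diagonalised:
  fixes A P Q :: "real Matrix.mat" and ds :: "real list"
  defines "B \<equiv> Matrix.mat (length ds) (length ds) (\<lambda>(i, j). if i = j then ds ! i else 0)"
  assumes A: "A \<in> carrier_mat (length ds) (length ds)"
    and P: "P \<in> carrier_mat (length ds) (length ds)"
    and Q: "Q \<in> carrier_mat (length ds) (length ds)"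
    and QP: "Q * P = 1\<^sub>m (length ds)"
    and AP: "A * P = P * B"
  shows "proots (char_poly A) = mset ds"
proof -
  have B: "B \<in> carrier_mat (length ds) (length ds)" by (simp add: B_def)
  have PQ: "P * Q = 1\<^sub>m (length ds)" using mat_mult_left_right_inverse[OF Q P QP] .
  have "A = A * (P * Q)" using A PQ by simp
  also have "\<dots> = P * B * Q" using A P Q AP by (simp add: assoc_mult_mat[symmetric])
  finally have "similar_mat A B" using A B P Q PQ QP by (intro similar_matI[of A B P Q "length ds"]) auto
  then have "char_poly A = char_poly B" by (rule char_poly_similar)
  also have "\<dots> = (\<Prod>a\<leftarrow>diag_mat B. [:- a, 1:])"
    using B by (rule char_poly_upper_triangular) (auto simp: B_def)
  also have "diag_mat B = ds" by (rule nth_equalityI) (auto simp: diag_mat_def B_def)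
  finally have "char_poly A = (\<Prod>a\<leftarrow>ds. [:- a, 1:])" .
  moreover have "proots (\<Prod>a\<leftarrow>ds. [:- a, 1:]) = mset ds"
  proof -
    have nz: "(\<Prod>a\<leftarrow>xs. [:- a, 1:]) \<noteq> 0" for xs :: "real list"
      by auto
    show ?thesis
    proof (induction ds)
      case (Cons a ds)
      then show ?case
        using proots_mult[of "[:- a, 1:]" "\<Prod>a\<leftarrow>ds. [:- a, 1:]"] nz[of ds]
        by (simp del: mult_pCons_left)
    qed simp
  qed
  ultimately show ?thesis by simp
qed

locale dual_distance_5_codes = dual_codes C Y + distance_5_code C for C Y :: "(gf4 ^ 'n) set"
begin

lemma C_nonempty: "C \<noteq> {}"
  using zero_mem by blast

lemma card_C_pos: "card C > 0"
  using C_nonempty by (simp add: card_gt_0_iff)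

lemma card_pverts: "card (pverts (coset_graph C)) = card Y"
proof -
  have "card C * card (pverts (coset_graph C)) = card C * card Y"
    using card_eq_card_cosets[of UNIV] card_C_Y card_gf4_vec[where 'n = 'n]
    by (simp only: pverts_coset_graph UNIV_I)
  then show ?thesis using C_nonempty by simp
qed

text \<open>Every fibre of the quotient map has \<open>card C\<close> elements.\<close>

lemma sum_over_cosets:
  "(\<Sum>x\<in>UNIV. h (coset x C)) = real (card C) * (\<Sum>W\<in>pverts (coset_graph C). h W)"
proof -
  have "(\<Sum>x\<in>UNIV. h (coset x C)) =
      (\<Sum>W\<in>pverts (coset_graph C). \<Sum>x\<in>{x\<in>UNIV. coset x C = W}. h (coset x C))"
    by (rule sum.group[symmetric]) (auto simp: pverts_coset_graph)
  also have "\<dots> = (\<Sum>W\<in>pverts (coset_graph C). real (card C) * h W)"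
  proof (rule sum.cong[OF refl])
    fix W assume "W \<in> pverts (coset_graph C)"
    then obtain w where w: "W = coset w C" by (auto simp: pverts_coset_graph)
    have "{x\<in>UNIV. coset x C = W} = coset w C"
      by (auto simp: w coset_eq_iff mem_coset_iff add.commute)
    also have "\<dots> = (+) w ` C" by (auto simp: coset_def)
    finally have "card {x\<in>UNIV. coset x C = W} = card C" by (simp add: card_image)
    moreover have "(\<Sum>x\<in>{x\<in>UNIV. coset x C = W}. h (coset x C)) = (\<Sum>x\<in>{x\<in>UNIV. coset x C = W}. h W)"
      by (rule sum.cong) auto
    ultimately show "(\<Sum>x\<in>{x\<in>UNIV. coset x C = W}. h (coset x C)) = real (card C) * h W" by simp
  qed
  finally show ?thesis by (simp add: sum_distrib_left)
qed

text \<open>The character of \<open>y\<close> read on cosets. For \<open>y\<close> in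
  \<open>Y\<close> the chosen representative does not matter, because the character is 1 on
  \<open>C\<close>.\<close>

definition coset_chr :: "gf4 ^ 'n \<Rightarrow> (gf4 ^ 'n) set \<Rightarrow> real" where
  "coset_chr y X = chr (SOME x. X = coset x C) y"

lemma coset_chr_coset:
  assumes "y \<in> Y"
  shows "coset_chr y (coset z C) = chr z y"
proof -
  define w where "w = (SOME x. coset z C = coset x C)"
  have "coset z C = coset w C" unfolding w_def by (rule someI) (rule refl)
  then have "z + w \<in> C" by (simp add: coset_eq_iff)
  then have "chr ((z + w) + z) y = chr z y"
    unfolding chr_add_left[of "z + w"] using orthogonal[OF _ assms] by simp
  also have "(z + w) + z = w" by (simp add: gf4_vec_ac)
  finally show ?thesis by (simp add: coset_chr_def w_def)
qed

text \<open>Pulled back to the whole space, the product of the two characters is the character of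
  \<open>y + y'\<close>, which sums to 0 unless \<open>y = y'\<close>.\<close>

lemma coset_chr_orthogonal:
  assumes "y \<in> Y" "y' \<in> Y"
  shows "(\<Sum>W\<in>pverts (coset_graph C). coset_chr y W * coset_chr y' W) =
    (if y = y' then real (card Y) else 0)"
proof -
  have "real (card C) * (\<Sum>W\<in>pverts (coset_graph C). coset_chr y W * coset_chr y' W) =
      (\<Sum>x\<in>UNIV. chr x (y + y'))"
    unfolding sum_over_cosets[symmetric] using assms by (simp add: coset_chr_coset chr_add_right)
  also have "y + y' = 0 \<longleftrightarrow> y = y'"
    by (simp flip: gf4_vec_diff_eq_add)
  then have "(\<Sum>x\<in>UNIV. chr x (y + y')) = real (card C) * (if y = y' then real (card Y) else 0)"
    unfolding sum_chr_UNIV using card_C_Y by (simp flip: of_nat_mult)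
  finally show ?thesis using C_nonempty by (simp only: mult_cancel_left) simp
qed

lemma coset_chr_eigen:
  assumes "y \<in> Y" "V \<in> pverts (coset_graph C)"
  shows "(\<Sum>W\<in>pverts (coset_graph C).
      (if (V, W) \<in> parcs (coset_graph C) then 1 else 0) * coset_chr y W) = eigval y * coset_chr y V"
proof -
  obtain x where x: "V = coset x C" using assms(2) by (auto simp: pverts_coset_graph)
  have "nbsum (\<lambda>z. chr z y) x = chr x y * (\<Sum>e\<in>units. chr e y)"
    by (simp add: nbsum_def chr_add_left sum_distrib_left)
  then have "nbsum (\<lambda>z. chr z y) x = eigval y * coset_chr y V"
    by (simp add: sum_chr_units eigval_def x coset_chr_coset[OF assms(1)])
  then show ?thesis unfolding x by (simp add: sum_adjacent[of "coset_chr y" "\<lambda>z. chr z y"] coset_chr_coset[OF assms(1)])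
qed

lemma has_spectrum_coset_graph:
  assumes ys: "distinct ys" "set ys = Y"
  shows "has_spectrum (coset_graph C) (mset (map eigval ys))"
  unfolding has_spectrum_def
proof (intro conjI allI impI)
  show fin: "finite (pverts (coset_graph C))" by simp
  fix vs assume vs: "distinct vs \<and> set vs = pverts (coset_graph C)"
  define n where "n = card Y"
  have len: "length vs = n" "length ys = n"
    using vs ys distinct_card[of vs] distinct_card[of ys] card_pverts by (auto simp: n_def)
  have n: "n > 0" using card_Y_pos by (simp add: n_def)
  have sum_vs: "(\<Sum>k = 0..<n. f (vs ! k)) = (\<Sum>W\<in>pverts (coset_graph C). f W)" for f :: "_ \<Rightarrow> real"
    using sum.reindex_bij_betw[OF bij_betw_nth[of vs "{..<n}" "pverts (coset_graph C)"], of f] vs len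
    by (simp add: atLeast0LessThan)
  have ysY: "ys ! j \<in> Y" if "j < n" for j using that len ys nth_mem[of j ys] by simp
  have vsV: "vs ! j \<in> pverts (coset_graph C)" if "j < n" for j using that len vs nth_mem[of j vs] by simp
  define A where "A = adjacency_mat (coset_graph C) vs"
  \<comment> \<open>The columns of \<open>P\<close> are the characters from \<open>Y\<close>; by
    orthogonality its transpose divided by \<open>n\<close> is its inverse \<open>Q\<close>.\<close>
  define P where "P = Matrix.mat n n (\<lambda>(i, j). coset_chr (ys ! j) (vs ! i))"
  define Q where "Q = Matrix.mat n n (\<lambda>(i, j). coset_chr (ys ! i) (vs ! j) / n)"
  define B where "B = Matrix.mat n n (\<lambda>(i, j). if i = j then map eigval ys ! i else 0)"
  have carrier: "A \<in> carrier_mat n n" "P \<in> carrier_mat n n" "Q \<in> carrier_mat n n"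
    by (simp_all add: A_def P_def Q_def adjacency_mat_def len)
  have "Q * P = 1\<^sub>m n"
  proof (rule eq_matI)
    fix i j assume ij: "i < dim_row (1\<^sub>m n :: real Matrix.mat)" "j < dim_col (1\<^sub>m n :: real Matrix.mat)"
    then have "(Q * P) $$ (i, j) =
        (\<Sum>k = 0..<n. coset_chr (ys ! i) (vs ! k) * coset_chr (ys ! j) (vs ! k) / n)"
      by (simp add: P_def Q_def scalar_prod_def)
    also have "\<dots> = (if ys ! i = ys ! j then 1 else 0)"
      using ij ysY n sum_vs[of "\<lambda>W. coset_chr (ys ! i) W * coset_chr (ys ! j) W"]
      unfolding sum_divide_distrib[symmetric] by (simp add: coset_chr_orthogonal flip: n_def)
    also have "\<dots> = 1\<^sub>m n $$ (i, j)"
      using ij ys len by (simp add: nth_eq_iff_index_eq)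
    finally show "(Q * P) $$ (i, j) = 1\<^sub>m n $$ (i, j)" .
  qed (simp_all add: P_def Q_def)
  moreover have "A * P = P * B"
  proof (rule eq_matI)
    fix i j assume "i < dim_row (P * B)" "j < dim_col (P * B)"
    then have ij: "i < n" "j < n" by (simp_all add: P_def B_def)
    then have "(A * P) $$ (i, j) = (\<Sum>k = 0..<n.
        (if (vs ! i, vs ! k) \<in> parcs (coset_graph C) then 1 else 0) * coset_chr (ys ! j) (vs ! k))"
      by (simp add: A_def P_def adjacency_mat_def scalar_prod_def len)
    also have "\<dots> = eigval (ys ! j) * coset_chr (ys ! j) (vs ! i)"
      using ij ysY vsV coset_chr_eigen[of "ys ! j" "vs ! i"]
        sum_vs[of "\<lambda>W. (if (vs ! i, W) \<in> parcs (coset_graph C) then 1 else 0) * coset_chr (ys ! j) W"]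
      by simp
    also have "\<dots> = (\<Sum>k = 0..<n. coset_chr (ys ! k) (vs ! i) * (if k = j then eigval (ys ! k) else 0))"
      using ij by (simp add: if_distrib[of "\<lambda>z. _ * z"] mult.commute cong: if_cong)
    also have "\<dots> = (P * B) $$ (i, j)"
      using ij by (simp add: P_def B_def scalar_prod_def) (auto simp: len intro!: sum.cong)
    finally show "(A * P) $$ (i, j) = (P * B) $$ (i, j)" .
  qed (simp_all add: A_def P_def B_def adjacency_mat_def len)
  ultimately show "proots (char_poly (adjacency_mat (coset_graph C) vs)) = mset (map eigval ys)"
    using carrier unfolding A_def B_def
    by (intro proots_char_poly_diagonalised[of _ _ P Q]) (simp_all add: len)
qed

end

subsection \<open>Distance-regularity\<close>

text \<open>At length 11 the weights 0, 6, 8, 10 give the eigenvalues 33, 9, 1, -7.\<close>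

locale three_weight_dual_code = dual_distance_5_codes C Y for C Y :: "(gf4 ^ 'n) set" +
  assumes length_11: "CARD('n) = 11"
    and card_Y: "card Y = 1024"
    and weights_Y: "\<And>y. y \<in> Y \<Longrightarrow> hamming_weight y \<in> {0, 6, 8, 10}"
begin

text \<open>
  The cubic is \<open>(t - 9)(t - 1)(t + 7)\<close>; its value at the trivial eigenvalue 33 is
  \<open>24 \<cdot> 32 \<cdot> 40 = 30 \<cdot> 1024\<close>.
\<close>

lemma eigval_cubic:
  assumes "y \<in> Y"
  shows "eigval y ^ 3 - 3 * eigval y ^ 2 - 61 * eigval y + 63 = (if y = 0 then 30 * 1024 else 0)"
proof -
  have "hamming_weight y = 0 \<longleftrightarrow> y = 0" by (rule hamming_weight_eq_0)
  with weights_Y[OF assms] show ?thesis by (auto simp: eigval_def length_11)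
qed

text \<open>In the Fourier expansion the cubic kills every character except the trivial one, which
  leaves \<open>30 * 1024 / 1024\<close>.\<close>

lemma nbsum_cubic:
  "(nbsum ^^ 3) (\<lambda>x. of_bool (x \<in> C)) x - 3 * (nbsum ^^ 2) (\<lambda>x. of_bool (x \<in> C)) x
    - 61 * nbsum (\<lambda>x. of_bool (x \<in> C)) x + 63 * of_bool (x \<in> C) = 30"
proof -
  note power = nbsum_power_indicator[of _ x]
  \<comment> \<open>The exponents 1 and 0 are written out so that
    \<open>nbsum_power_indicator\<close> rewrites all four terms.\<close>
  have "(nbsum ^^ 3) (\<lambda>x. of_bool (x \<in> C)) x - 3 * (nbsum ^^ 2) (\<lambda>x. of_bool (x \<in> C)) x
      - 61 * (nbsum ^^ 1) (\<lambda>x. of_bool (x \<in> C)) x + 63 * (nbsum ^^ 0) (\<lambda>x. of_bool (x \<in> C)) x =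
    (\<Sum>y\<in>Y. (eigval y ^ 3 - 3 * eigval y ^ 2 - 61 * eigval y ^ 1 + 63 * eigval y ^ 0) * chr x y) / 1024"
    unfolding power card_Y
    by (simp add: sum_subtractf sum.distrib sum_distrib_left ring_distribs diff_divide_distrib
        add_divide_distrib mult.assoc)
  also have "(\<Sum>y\<in>Y. (eigval y ^ 3 - 3 * eigval y ^ 2 - 61 * eigval y ^ 1 + 63 * eigval y ^ 0) * chr x y) =
      (\<Sum>y\<in>Y. if y = 0 then 30 * 1024 else 0)"
    by (rule sum.cong) (simp_all add: eigval_cubic)
  also have "\<dots> = 30 * 1024" using f2.subspace_0[OF subspace_Y] by simp
  finally show ?thesis by simp
qed

text \<open>Twice the cubic relation after expanding the powers of \<open>nbsum\<close>. It
  determines \<open>nb_count x 2\<close> from \<open>D x\<close>.\<close>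

lemma nb_count_2: "66 * real (nb_count x 0) + 4 * real (nb_count x 2) =
    60 + 2 * real (nb_count x 1) + 122 * of_bool (D x = 1) - 126 * of_bool (D x = 0)"
  using nbsum_cubic[of x] unfolding nbsum_1 nbsum_2 nbsum_3 length_11
  by (simp add: coset_weight_eq_0_iff)

text \<open>At coset weight 4 or more, all counts in \<open>nb_count_2\<close> vanish and the
  relation reads \<open>0 = 60\<close>.\<close>

lemma coset_weight_le_3: "D x \<le> 3"
proof (rule ccontr)
  assume "\<not> D x \<le> 3"
  then show False using nb_count_2[of x] nb_count_0[of x] nb_count_1[of x] nb_count_eq_0[of 2 x] by simp
qed

lemma nb_count_at_0: "D x = 0 \<Longrightarrow> nb_count x 1 = 33"
  using nb_count_1[of x] by (simp add: length_11)

text \<open>Of the 33 units, one leads to \<open>C\<close> and two stay at weight 1, so 30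
  remain.\<close>

lemma nb_count_at_1:
  assumes "D x = 1"
  shows "nb_count x 0 = 1" "nb_count x 2 = 30"
proof -
  show "nb_count x 0 = 1" using assms by (simp add: nb_count_0)
  have "D (x + e) \<in> {0, 1, 2}" if "e \<in> units" for e
    using coset_weight_add_unit_le[OF that, of x] assms by auto
  from sum_nb_count[OF _ this] show "nb_count x 2 = 30"
    using assms nb_count_0[of x] nb_count_1[of x] by (simp add: length_11)
qed

text \<open>Here \<open>nb_count_2\<close> reads \<open>4 * nb_count x 2 = 60 + 2 * 2\<close>, so 16
  units keep the coset weight and \<open>33 - 2 - 16 = 15\<close> raise it.\<close>

lemma nb_count_at_2:
  assumes "D x = 2"
  shows "nb_count x 1 = 2" "nb_count x 3 = 15"
proof -
  show 1: "nb_count x 1 = 2" using nb_count_1[of x] assms by simp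
  have 2: "nb_count x 2 = 16" using nb_count_2[of x] 1 assms by (simp add: nb_count_0)
  have "D (x + e) \<in> {1, 2, 3}" if "e \<in> units" for e
    using coset_weight_add_unit_le[OF that, of x] coset_weight_le_add_unit[OF that, of x] assms by auto
  from sum_nb_count[OF _ this] show "nb_count x 3 = 15" using 1 2 by (simp add: length_11)
qed

text \<open>Here \<open>nb_count_2\<close> reads \<open>4 * nb_count x 2 = 60\<close>.\<close>

lemma nb_count_at_3:
  assumes "D x = 3"
  shows "nb_count x 2 = 15" "nb_count x 4 = 0"
proof -
  show "nb_count x 2 = 15" using nb_count_2[of x] nb_count_1[of x] assms by (simp add: nb_count_0)
  have "D (x + e) \<noteq> 4" for e using coset_weight_le_3[of "x + e"] by simp
  then show "nb_count x 4 = 0" by (simp add: nb_count_def)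
qed

lemma distance_regular_coset_graph: "distance_regular (coset_graph C)"
  unfolding distance_regular_def
proof (intro conjI exI ballI allI)
  show "pair_graph (coset_graph C)" by (rule pair_graph_coset_graph)
  show "Digraph_Component.connected (with_proj (coset_graph C))" by (rule connected_coset_graph)
  \<comment> \<open>The entry \<open>c 0\<close> is a dummy. Spheres of radius above 3 are empty, so
    the lists are never read beyond their end.\<close>
  define b c :: "nat \<Rightarrow> nat" where "b i = [33, 30, 15, 0] ! i" and "c i = [0, 1, 2, 15] ! i" for i
  fix u v i
  assume u: "u \<in> pverts (coset_graph C)" and v: "v \<in> sphere_at (coset_graph C) u i"
  obtain x where x: "u = coset x C" using u by (auto simp: pverts_coset_graph)
  obtain y where y: "v = coset y C" "D (x + y) = i" using v by (auto simp: x sphere_at_coset_graph)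
  have "i \<le> 3" using coset_weight_le_3[of "x + y"] y by simp
  then have i: "i = 0 \<or> i = 1 \<or> i = 2 \<or> i = 3" by linarith
  show "card (neighbours (coset_graph C) v \<inter> sphere_at (coset_graph C) u (i + 1)) = b i"
    unfolding x y(1) card_neighbours_sphere b_def
    using i y(2) nb_count_at_0[of "x + y"] nb_count_at_1[of "x + y"] nb_count_at_2[of "x + y"] nb_count_at_3[of "x + y"]
    by (elim disjE) (simp_all flip: numeral_2_eq_2)
  show "i \<ge> 1 \<longrightarrow> card (neighbours (coset_graph C) v \<inter> sphere_at (coset_graph C) u (i - 1)) = c i"
    unfolding x y(1) card_neighbours_sphere c_def
    using i y(2) nb_count_at_1[of "x + y"] nb_count_at_2[of "x + y"] nb_count_at_3[of "x + y"]
    by (elim disjE) simp_all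
qed

lemma card_coset_weight:
  "card {x. D x = 0} = card C" "card {x. D x = 1} = 33 * card C"
  "card {x. D x = 2} = 495 * card C" "card {x. D x = 3} = 495 * card C"
proof -
  show 0: "card {x. D x = 0} = card C" by (simp add: coset_weight_eq_0_iff)
  show 1: "card {x. D x = 1} = 33 * card C" using card_coset_weight_1 by (simp add: length_11)
  show 2: "card {x. D x = 2} = 495 * card C" using card_coset_weight_2 by (simp add: length_11)
  \<comment> \<open>The last count is what remains of the \<open>1024 * card C\<close>
    vectors.\<close>
  have "UNIV = (\<Union>j\<le>3. {x. D x = j})" using coset_weight_le_3 by auto
  then have "CARD(gf4 ^ 'n) = card (\<Union>j\<le>3. {x. D x = j})" by simp
  also have "\<dots> = (\<Sum>j\<le>3. card {x. D x = j})" by (rule card_UN_disjoint) auto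
  finally have "1024 * card C = (\<Sum>j\<le>3. card {x. D x = j})"
    using card_C_Y card_Y by (simp add: card_gf4)
  also have "\<dots> = card {x. D x = 0} + card {x. D x = 1} + card {x. D x = 2} + card {x. D x = 3}"
    by (simp add: numeral_eq_Suc)
  finally show "card {x. D x = 3} = 495 * card C" unfolding 0 1 2 by simp
qed

lemma card_spheres:
  assumes "u \<in> pverts (coset_graph C)"
  shows "map (\<lambda>i. card (sphere_at (coset_graph C) u i)) [0, 1, 2, 3] = [1, 33, 495, 495]"
proof -
  obtain x where x: "u = coset x C" using assms by (auto simp: pverts_coset_graph)
  show ?thesis
    using card_sphere_at[of 0 x] card_sphere_at[of 1 x] card_sphere_at[of 2 x] card_sphere_at[of 3 x]
      card_C_pos unfolding x card_coset_weight by auto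
qed

lemma diameter_coset_graph: "diameter (coset_graph C) = 3"
proof -
  have le: "graph_dist (coset_graph C) u v \<le> 3"
    if uv: "u \<in> pverts (coset_graph C)" "v \<in> pverts (coset_graph C)" for u v
  proof -
    obtain x y where "u = coset x C" "v = coset y C" using uv[unfolded pverts_coset_graph] by blast
    then show ?thesis
      using coset_weight_le_3[of "x + y"] by (simp add: graph_dist_coset_graph)
  qed
  \<comment> \<open>The bound 3 is attained because the sphere of radius 3 is nonempty.\<close>
  have "card {x. D x = 3} \<noteq> 0" using card_coset_weight(4) card_C_pos by linarith
  then have "{x. D x = 3} \<noteq> {}" by (metis card.empty)
  then obtain z where z: "D z = 3" by blast
  then have "graph_dist (coset_graph C) (coset 0 C) (coset z C) = 3"
    by (simp add: graph_dist_coset_graph)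
  moreover have "graph_dist (coset_graph C) (coset 0 C) (coset z C) \<le> diameter (coset_graph C)"
    unfolding diameter_def by (intro SUP_upper2[of "coset 0 C"] SUP_upper) (auto simp: pverts_coset_graph)
  moreover have "diameter (coset_graph C) \<le> 3"
    unfolding diameter_def using le by (intro SUP_least) auto
  ultimately show ?thesis by simp
qed

end
subsection \<open>The punctured dodecacode\<close>

text \<open>With one argument fixed, the vectors of character value 1 form a subspace; the span is
  taken first on the left, then on the right.\<close>

lemma chr_span:
  assumes "\<And>a b. a \<in> A \<Longrightarrow> b \<in> B \<Longrightarrow> chr a b = 1" "x \<in> f2.span A" "y \<in> f2.span B"
  shows "chr x y = 1"
proof -
  have subspace: "f2.subspace {x. chr x z = 1}" for z :: "gf4 ^ 'n"
    by (rule f2.subspaceI) (auto simp: chr_add_left f2_scale_def)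
  have "B \<subseteq> {b. chr b x = 1}"
  proof
    fix b assume "b \<in> B"
    then have "A \<subseteq> {a. chr a b = 1}" using assms(1) by blast
    from f2.span_minimal[OF this subspace] show "b \<in> {b. chr b x = 1}"
      using assms(2) chr_commute[of b x] by auto
  qed
  from f2.span_minimal[OF this subspace] show ?thesis
    using assms(3) chr_commute[of x y] by auto
qed

lemma chr_vector_11:
  assumes "length a = 11" "length b = 11"
  shows "chr (vector a) (vector b :: gf4 ^ 11) = prod_list (map2 psi a b)"
proof -
  have "chr (vector a) (vector b :: gf4 ^ 11) = (\<Prod>k<11. psi (a ! k) (b ! k))"
    unfolding chr_def prod.reindex_bij_betw[OF bij_betw_of_nat_Suc_11, symmetric]
    using assms by (intro prod.cong) (simp_all add: vector_nth_11 del: of_nat_Suc)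
  also have "\<dots> = prod_list (map2 psi a b)"
    using assms by (simp add: prod.list_conv_set_nth atLeast0LessThan)
  finally show ?thesis .
qed

section \<open>Evaluation on the twelve generators\<close>

definition gens :: "gf4 list list" where
  "gens =
    [[0, 0, 0, 0, 0, \<omega>\<^sup>2, \<omega>\<^sup>2, 0, \<omega>, 1, \<omega>],
     [0, 0, 0, 0, 0, \<omega>, 0, \<omega>, \<omega>, \<omega>, 1],
     [1, 0, 0, 0, 0, 1, 0, 1, \<omega>\<^sup>2, \<omega>\<^sup>2, 1],
     [\<omega>, 0, 0, 0, 0, 0, \<omega>, 1, \<omega>, \<omega>, \<omega>],
     [0, 1, 0, 0, 0, 0, 1, 1, 1, \<omega>\<^sup>2, \<omega>\<^sup>2],
     [0, \<omega>, 0, 0, 0, \<omega>\<^sup>2, 1, \<omega>\<^sup>2, \<omega>, \<omega>, 0],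
     [0, 0, 1, 0, 0, \<omega>, \<omega>, 1, 1, 0, 1],
     [0, 0, \<omega>, 0, 0, \<omega>, 1, \<omega>, \<omega>\<^sup>2, \<omega>\<^sup>2, 0],
     [0, 0, 0, 1, 0, \<omega>, \<omega>, \<omega>, 0, 1, \<omega>],
     [0, 0, 0, \<omega>, 0, \<omega>\<^sup>2, 1, 1, \<omega>\<^sup>2, 0, \<omega>],
     [0, 0, 0, 0, 1, \<omega>\<^sup>2, \<omega>\<^sup>2, \<omega>\<^sup>2, 1, 0, \<omega>\<^sup>2],
     [0, 0, 0, 0, \<omega>, \<omega>, 1, 0, 1, \<omega>, \<omega>]]"

lemmas gens_eq = gens_def[unfolded zero_gf4_def one_gf4_def power2_eq_square times_gf4.simps]

abbreviation gen_vecs :: "(gf4 ^ 11) list" where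
  "gen_vecs \<equiv> map vector gens"

text \<open>The ten generators left after dropping the first two are orthogonal to all twelve; they
  span the trace dual.\<close>

abbreviation dual_vecs :: "(gf4 ^ 11) list" where
  "dual_vecs \<equiv> map vector (drop 2 gens)"

lemma D_minus_eq: "D_minus = f2.span (set gen_vecs)"
  by (simp add: D_minus_def gens_def)

lemma length_11_gens: "h \<in> set gens \<Longrightarrow> length h = 11"
  by (auto simp: gens_def)

lemma length_gens: "length gens = 12"
  by (simp add: gens_def)

lemma gens_orthogonal:
  assumes "a \<in> set gen_vecs" "b \<in> set dual_vecs"
  shows "chr a b = 1"
proof -
  have "\<forall>a\<in>set gens. \<forall>b\<in>set (drop 2 gens). prod_list (map2 psi a b) = 1"
    by (simp add: gens_eq psi_def zero_gf4_def)
  moreover obtain l l' where "l \<in> set gens" "a = vector l" "l' \<in> set (drop 2 gens)" "b = vector l'"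
    using assms by auto
  moreover from this have "length l = 11" "length l' = 11"
    using length_11_gens by (auto dest: in_set_dropD)
  ultimately show ?thesis by (simp add: chr_vector_11)
qed

lemma length_filter_combos:
  assumes "set hs \<subseteq> set gens"
  shows "length (filter (\<lambda>x. P (hamming_weight x)) (combos (map (\<lambda>l. vector l :: gf4 ^ 11) hs))) =
    count_combos P hs (replicate 11 GF4_0)"
proof -
  have "vector (replicate 11 GF4_0) = (0 :: gf4 ^ 11)"
    by (simp add: vec_eq_iff_11 vector_nth_11 zero_gf4_def del: of_nat_Suc)
  then show ?thesis
    using assms length_11_gens by (subst count_combos_correct) auto
qed

text \<open>The one hit among the 4096 combinations is the zero word. This gives both the minimum
  distance and the independence of the generators.\<close>

lemma count_low_weight: "count_combos (\<lambda>w. w < 5) gens (replicate 11 GF4_0) = 1"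
  by code_simp

text \<open>The four counts add up to \<open>2 ^ 10\<close>, which leaves no combination for another
  weight.\<close>

lemma count_dual_weights:
  "count_combos (\<lambda>w. w = 0) (drop 2 gens) (replicate 11 GF4_0) = 1"
  "count_combos (\<lambda>w. w = 6) (drop 2 gens) (replicate 11 GF4_0) = 198"
  "count_combos (\<lambda>w. w = 8) (drop 2 gens) (replicate 11 GF4_0) = 495"
  "count_combos (\<lambda>w. w = 10) (drop 2 gens) (replicate 11 GF4_0) = 330"
  by code_simp+

lemma low_weight_combos: "filter (\<lambda>x. hamming_weight x < 5) (combos gen_vecs) = [0]"
proof -
  have "length (filter (\<lambda>x. hamming_weight x < 5) (combos gen_vecs)) = 1"
    using length_filter_combos[of gens "\<lambda>w. w < 5"] count_low_weight by simp
  then obtain z where z: "filter (\<lambda>x. hamming_weight x < 5) (combos gen_vecs) = [z]"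
    by (auto simp: length_Suc_conv)
  have "0 \<in> set (filter (\<lambda>x. hamming_weight x < 5) (combos gen_vecs))"
    by (simp add: set_combos f2.span_zero)
  with z show ?thesis by simp
qed

lemma D_minus_min_distance: "c \<in> D_minus \<Longrightarrow> c \<noteq> 0 \<Longrightarrow> hamming_weight c \<ge> 5"
proof (rule ccontr)
  assume "c \<in> D_minus" "c \<noteq> 0" "\<not> hamming_weight c \<ge> 5"
  then have "c \<in> set (filter (\<lambda>x. hamming_weight x < 5) (combos gen_vecs))"
    by (simp add: D_minus_eq set_combos)
  with \<open>c \<noteq> 0\<close> show False by (simp add: low_weight_combos del: set_filter)
qed

lemma card_D_minus: "card D_minus = 4096"
proof -
  \<comment> \<open>Zero has weight below 5, so the low-weight list already shows that it occurs
    once.\<close>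
  have "filter (\<lambda>x. x = 0) (combos gen_vecs) =
      filter (\<lambda>x. x = 0) (filter (\<lambda>x. hamming_weight x < 5) (combos gen_vecs))"
    by (auto intro!: filter_cong)
  then have "distinct (combos gen_vecs)"
    by (intro distinct_combos) (simp add: low_weight_combos del: filter_filter)
  from distinct_card[OF this] show ?thesis
    by (simp add: D_minus_eq set_combos length_combos length_gens)
qed

lemma distinct_dual: "distinct (combos dual_vecs)"
proof (rule distinct_combos)
  have "length (filter (\<lambda>x. hamming_weight x = 0) (combos dual_vecs)) = 1"
    using length_filter_combos[of "drop 2 gens" "\<lambda>w. w = 0"] count_dual_weights(1)
    by (simp add: set_drop_subset)
  then show "length (filter (\<lambda>x. x = 0) (combos dual_vecs)) = 1" by (simp add: hamming_weight_eq_0)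
qed

lemma length_dual: "length (combos dual_vecs) = 1024"
  by (simp add: length_combos length_gens)

lemma count_mset_map: "count (mset (map f xs)) w = length (filter (\<lambda>x. f x = w) xs)"
  by (induction xs) auto

text \<open>An inclusion of multisets of equal size 1024 is an equality, so four evaluated counts
  suffice.\<close>

lemma dual_weights:
  "mset (map hamming_weight (combos dual_vecs)) =
    replicate_mset 1 0 + replicate_mset 198 6 + replicate_mset 495 8 + replicate_mset 330 10"
    (is "?M = ?N")
proof -
  have count_M: "count ?M w = count_combos (\<lambda>v. v = w) (drop 2 gens) (replicate 11 GF4_0)" for w
  proof -
    have "count ?M w = length (filter (\<lambda>x. hamming_weight x = w) (combos dual_vecs))"
      by (rule count_mset_map)
    also have "\<dots> = count_combos (\<lambda>v. v = w) (drop 2 gens) (replicate 11 GF4_0)"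
      by (rule length_filter_combos) (rule set_drop_subset)
    finally show ?thesis .
  qed
  have "?N \<subseteq># ?M"
  proof (rule mset_subset_eqI)
    fix w :: nat
    consider "w = 0" | "w = 6" | "w = 8" | "w = 10" | "w \<notin> {0, 6, 8, 10}" by blast
    then show "count ?N w \<le> count ?M w"
      by cases (simp_all only: count_M count_dual_weights count_union count_replicate_mset, simp_all)
  qed
  moreover have "size ?N = size ?M" by (simp add: length_dual)
  ultimately show ?thesis
    by (metis mset_subset_size less_irrefl subset_mset.le_imp_less_or_eq)
qed

interpretation D_minus: three_weight_dual_code D_minus "f2.span (set dual_vecs)"
proof
  show "f2.subspace D_minus" by (simp add: D_minus_eq)
  show "f2.subspace (f2.span (set dual_vecs))" by simp
  show "chr x y = 1" if "x \<in> D_minus" "y \<in> f2.span (set dual_vecs)" for x y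
    using that unfolding D_minus_eq by (rule chr_span[rotated]) (rule gens_orthogonal)
  show card: "card (f2.span (set dual_vecs)) = 1024"
    using distinct_card[OF distinct_dual] by (simp add: set_combos length_dual)
  show "card D_minus * card (f2.span (set dual_vecs)) = 4 ^ CARD(11)"
    by (simp only: card card_D_minus) simp
  show "hamming_weight c \<ge> 5" if "c \<in> D_minus" "c \<noteq> 0" for c
    using that by (rule D_minus_min_distance)
  show "CARD(11) = 11" by simp
  show "hamming_weight y \<in> {0, 6, 8, 10}" if "y \<in> f2.span (set dual_vecs)" for y
  proof -
    have "hamming_weight y \<in># mset (map hamming_weight (combos dual_vecs))"
      using that by (simp add: set_combos)
    then show ?thesis unfolding dual_weights by auto
  qed
qed

theorem theorem7:
  shows "card (pverts (coset_graph D_minus)) = 2 ^ 10 \<and>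
    distance_regular (coset_graph D_minus) \<and>
    diameter (coset_graph D_minus) = 3 \<and>
    has_spectrum (coset_graph D_minus)
      (replicate_mset 1 33 + replicate_mset 198 9 + replicate_mset 495 1 + replicate_mset 330 (-7)) \<and>
    (\<forall>x \<in> pverts (coset_graph D_minus).
      map (\<lambda>i. card (sphere_at (coset_graph D_minus) x i)) [0, 1, 2, 3] = [1, 33, 495, 495])"
proof (intro conjI ballI)
  show "card (pverts (coset_graph D_minus)) = 2 ^ 10"
    by (simp only: D_minus.card_pverts D_minus.card_Y) simp
  show "distance_regular (coset_graph D_minus)"
    by (rule D_minus.distance_regular_coset_graph)
  show "diameter (coset_graph D_minus) = 3"
    by (rule D_minus.diameter_coset_graph)
  \<comment> \<open>The map \<open>w \<mapsto> 33 - 4 * w\<close> carries the weight distribution of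
    the dual to the spectrum.\<close>
  have "mset (map D_minus.eigval (combos dual_vecs)) =
      image_mset (\<lambda>w. 33 - 4 * real w) (mset (map hamming_weight (combos dual_vecs)))"
    by (auto simp: image_mset.compositionality comp_def D_minus.eigval_def intro!: image_mset_cong)
  also have "\<dots> = replicate_mset 1 33 + replicate_mset 198 9 + replicate_mset 495 1 + replicate_mset 330 (-7)"
    unfolding dual_weights by (simp only: image_mset_union image_replicate_mset) simp
  finally show "has_spectrum (coset_graph D_minus)
      (replicate_mset 1 33 + replicate_mset 198 9 + replicate_mset 495 1 + replicate_mset 330 (-7))"
    using D_minus.has_spectrum_coset_graph[OF distinct_dual set_combos] by simp
  show "map (\<lambda>i. card (sphere_at (coset_graph D_minus) x i)) [0, 1, 2, 3] = [1, 33, 495, 495]"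
    if "x \<in> pverts (coset_graph D_minus)" for x
    using that by (rule D_minus.card_spheres)
qed

end
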